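(* For a security game with $n$ targets, attacker pure strategies $\mathcal A=\{A\subseteq[n]:|A|\le c\}$ ($c>1$ constant), defender pure strategy space $\mathcal D$ and support set $S$, the defender oracle problem (linear optimization over the vertex set $I_d$ for an arbitrary weight vector in $\mathbb R^{2|S|}$) is equivalent, via a $\mathrm{poly}(n)$ time transformation, to the problem of maximizing a pseudo-Boolean function over the set system $\varepsilon$: for any vector $\mathbf{w}\in\mathbb{R}^{|S|}$ (indexed by $S$), solve $$\max_{\mathbf{x}\in\varepsilon}\left[\sum_{V\in S}\mathbf{w}_{V}\prod_{i\in V}\mathbf{x}_i\right].$$
   Context: Game: targets $[n]=\{1,\dots,n\}$; the defender's pure strategies form a collection $\mathcal{D}\subseteq 2^{[n]}$ ($D\in\mathcal D$ is the set of protected targets), $N_d=|\mathcal D|$, and $\Delta_{N_d}$ is the simplex of probability vectors indexed by $\mathcal D$. There are real set functions $B_a,L_a$ (attacker's benefit and loss) and $B_d,L_d$ (defender's benefit and loss), not necessarily additive. Common utilities: $B_a^c(U)=\sum_{V\subseteq U}(-1)^{|U\setminus V|}B_a(V)$, and similarly $L_a^c,B_d^c,L_d^c$. Support set: $S=\{A\in\mathcal A : B_a^c(A)\neq0\text{ or }B_d^c(A)\ne0\text{ or }L_a^c(A)\ne0\text{ or }L_d^c(A)\neq 0\}$. Polytope: let $\mathbf J,\mathbf K$ be the $\mathcal A\times\mathcal D$ binary matrices with $\mathbf J_{A,D}=1$ iff $A\subseteq D^c=[n]\setminus D$ and $\mathbf K_{A,D}=1$ iff $A\subseteq D$. Let $\pi_S$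 restrict a vector indexed by $\mathcal A$ to the coordinates in $S$. $H_d=\{(\pi_S(\mathbf J\mathbf q),\pi_S(\mathbf K\mathbf q)) : \mathbf q\in\Delta_{N_d}\}\subset\mathbb R^{2|S|}$, and $I_d$ is its set of vertices. Defender oracle problem: for any given $\mathbf w\in\mathbb R^{2|S|}$, determine $\arg\min_{\mathbf x\in I_d}\mathbf w^T\mathbf x$ (equivalently, replacing $\mathbf w$ by $-\mathbf w$, maximize). Set system: $\varepsilon\subseteq\{0,1\}^n$ is the set of indicator vectors of the sets $D\in\mathcal D$, i.e. $\mathbf x_i=1$ iff $i\in D$.
   Formalization: The reduction from the defender oracle problem to pseudo-Boolean maximization over the same S is claimed only if S contains all nonempty subsets of its members; otherwise the sum runs over S together with those subsets, as the claim fails for S={{1,2}}, D={∅,{1}}. *)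

theory Defs
  imports Complex_Main
    "HOL-Library.Indicator_Function"
    "HOL-Computational_Algebra.Polynomial"
begin

section \<open>Security games\<close>

definition attacks :: "nat \<Rightarrow> nat \<Rightarrow> nat set set" where
  "attacks n c = {A. A \<subseteq> {1..n} \<and> card A \<le> c}"

definition common_utility :: "(nat set \<Rightarrow> real) \<Rightarrow> nat set \<Rightarrow> real" where
  "common_utility B U = (\<Sum>V\<in>Pow U. (- 1) ^ card (U - V) * B V)"

definition support_set ::
  "nat \<Rightarrow> nat \<Rightarrow> (nat set \<Rightarrow> real) \<Rightarrow> (nat set \<Rightarrow> real) \<Rightarrow> (nat set \<Rightarrow> real) \<Rightarrow> (nat set \<Rightarrow> real)
    \<Rightarrow> nat set set" where
  "support_set n c Ba La Bd Ld =
     {A \<in> attacks n c. common_utility Ba A \<noteq> 0 \<or> common_utility Bd A \<noteq> 0 \<or>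
                       common_utility La A \<noteq> 0 \<or> common_utility Ld A \<noteq> 0}"

definition mixed_strategies :: "nat set set \<Rightarrow> (nat set \<Rightarrow> real) set" where
  "mixed_strategies \<D> = {q. (\<forall>D\<in>\<D>. 0 \<le> q D) \<and> (\<Sum>D\<in>\<D>. q D) = 1}"

definition matJ :: "nat \<Rightarrow> nat set \<Rightarrow> nat set \<Rightarrow> real" where
  "matJ n A D = (if A \<subseteq> {1..n} - D then 1 else 0)"

definition matK :: "nat set \<Rightarrow> nat set \<Rightarrow> real" where
  "matK A D = (if A \<subseteq> D then 1 else 0)"

text \<open>
  A vector of the \<open>2|S|\<close>-dimensional space is a function on the disjoint sum of two copies of
  the index sets, \<open>Inl\<close> for the \<open>J\<close>-block and \<open>Inr\<close> for the \<open>K\<close>-block, that vanishes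
  outside \<open>S <+> S\<close>.
\<close>

definition proj_pair ::
  "nat set set \<Rightarrow> (nat set \<Rightarrow> real) \<Rightarrow> (nat set \<Rightarrow> real) \<Rightarrow> nat set + nat set \<Rightarrow> real" where
  "proj_pair S u v i =
     (case i of Inl A \<Rightarrow> if A \<in> S then u A else 0 | Inr A \<Rightarrow> if A \<in> S then v A else 0)"

definition defender_polytope ::
  "nat \<Rightarrow> nat set set \<Rightarrow> nat set set \<Rightarrow> (nat set + nat set \<Rightarrow> real) set" where
  "defender_polytope n \<D> S =
     {proj_pair S (\<lambda>A. \<Sum>D\<in>\<D>. matJ n A D * q D) (\<lambda>A. \<Sum>D\<in>\<D>. matK A D * q D) | q.
        q \<in> mixed_strategies \<D>}"

text \<open>
  Extreme points, spelled out because the function type is not an instance of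
  \<open>real_vector\<close> in the libraries.
\<close>

definition vertices :: "('i \<Rightarrow> real) set \<Rightarrow> ('i \<Rightarrow> real) set" where
  "vertices H =
     {x \<in> H. \<not> (\<exists>y\<in>H. \<exists>z\<in>H. \<exists>t. y \<noteq> z \<and> 0 < t \<and> t < 1 \<and> x = (\<lambda>i. (1 - t) * y i + t * z i))}"

definition defender_vertices ::
  "nat \<Rightarrow> nat set set \<Rightarrow> nat set set \<Rightarrow> (nat set + nat set \<Rightarrow> real) set" where
  "defender_vertices n \<D> S = vertices (defender_polytope n \<D> S)"

definition oracle_objective ::
  "nat set set \<Rightarrow> (nat set + nat set \<Rightarrow> real) \<Rightarrow> (nat set + nat set \<Rightarrow> real) \<Rightarrow> real" where
  "oracle_objective S w x = (\<Sum>i\<in>S <+> S. w i * x i)"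

definition set_system :: "nat set set \<Rightarrow> (nat \<Rightarrow> real) set" where
  "set_system \<D> = (\<lambda>D. indicator D) ` \<D>"

definition pseudo_boolean :: "nat set set \<Rightarrow> (nat set \<Rightarrow> real) \<Rightarrow> (nat \<Rightarrow> real) \<Rightarrow> real" where
  "pseudo_boolean S w x = (\<Sum>V\<in>S. w V * (\<Prod>i\<in>V. x i))"


section \<open>Running time: a unit-cost real RAM\<close>

text \<open>
  Two memories, one of naturals and one of reals, both with indirect addressing. Natural
  arithmetic is restricted to addition and truncated subtraction, so that the bit length of a
  natural grows by at most a constant per step; real arithmetic is exact. A program is a fixed
  finite text, hence so is the size of every expression in it, and each executed command or
  test counts one step.
\<close>

datatype nexp = NConst nat | NLoad nexp | NAdd nexp nexp | NSub nexp nexp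

datatype rexp = RConst int | RLoad nexp
  | RAdd rexp rexp | RSub rexp rexp | RMul rexp rexp | RDiv rexp rexp

datatype test = NLess nexp nexp | RLess rexp rexp | TNot test | TAnd test test

datatype prog = Skip | NStore nexp nexp | RStore nexp rexp
  | Seq prog prog | Cond test prog prog | Loop test prog

type_synonym memory = "(nat \<Rightarrow> nat) \<times> (nat \<Rightarrow> real)"

fun nval :: "nexp \<Rightarrow> memory \<Rightarrow> nat" where
  "nval (NConst k) s = k"
| "nval (NLoad a) s = fst s (nval a s)"
| "nval (NAdd a b) s = nval a s + nval b s"
| "nval (NSub a b) s = nval a s - nval b s"

fun rval :: "rexp \<Rightarrow> memory \<Rightarrow> real" where
  "rval (RConst k) s = of_int k"
| "rval (RLoad a) s = snd s (nval a s)"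
| "rval (RAdd a b) s = rval a s + rval b s"
| "rval (RSub a b) s = rval a s - rval b s"
| "rval (RMul a b) s = rval a s * rval b s"
| "rval (RDiv a b) s = rval a s / rval b s"

fun tval :: "test \<Rightarrow> memory \<Rightarrow> bool" where
  "tval (NLess a b) s = (nval a s < nval b s)"
| "tval (RLess a b) s = (rval a s < rval b s)"
| "tval (TNot b) s = (\<not> tval b s)"
| "tval (TAnd b c) s = (tval b s \<and> tval c s)"

text \<open>\<open>exec P s t s'\<close>: started in \<open>s\<close>, program \<open>P\<close> halts in \<open>s'\<close> after exactly \<open>t\<close> steps.\<close>

inductive exec :: "prog \<Rightarrow> memory \<Rightarrow> nat \<Rightarrow> memory \<Rightarrow> bool" where
  exec_Skip: "exec Skip s 1 s"
| exec_NStore: "exec (NStore a b) s 1 ((fst s)(nval a s := nval b s), snd s)"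
| exec_RStore: "exec (RStore a r) s 1 (fst s, (snd s)(nval a s := rval r s))"
| exec_Seq: "exec P s t1 s1 \<Longrightarrow> exec Q s1 t2 s2 \<Longrightarrow> exec (Seq P Q) s (t1 + t2) s2"
| exec_CondT: "tval b s \<Longrightarrow> exec P s t s1 \<Longrightarrow> exec (Cond b P Q) s (1 + t) s1"
| exec_CondF: "\<not> tval b s \<Longrightarrow> exec Q s t s1 \<Longrightarrow> exec (Cond b P Q) s (1 + t) s1"
| exec_LoopF: "\<not> tval b s \<Longrightarrow> exec (Loop b P) s 1 s"
| exec_LoopT: "tval b s \<Longrightarrow> exec P s t1 s1 \<Longrightarrow> exec (Loop b P) s1 t2 s2 \<Longrightarrow>
    exec (Loop b P) s (1 + t1 + t2) s2"

definition initial :: "nat list \<Rightarrow> real list \<Rightarrow> memory" where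
  "initial ns rs = (\<lambda>k. if k < length ns then ns ! k else 0, \<lambda>k. if k < length rs then rs ! k else 0)"

text \<open>On the given inputs, \<open>P\<close> halts within \<open>T\<close> steps with \<open>out\<close> at the start of the real memory.\<close>

definition computes_within :: "prog \<Rightarrow> nat \<Rightarrow> nat list \<Rightarrow> real list \<Rightarrow> real list \<Rightarrow> bool" where
  "computes_within P T ns rs out \<longleftrightarrow>
     (\<exists>t s. t \<le> T \<and> exec P (initial ns rs) t s \<and> (\<forall>k<length out. snd s k = out ! k))"

text \<open>
  Families of subsets of \<open>{1..n}\<close> are handed to programs as incidence matrices, row by row, in
  an arbitrary order without repetition; vectors indexed by a family are listed in the same
  order.
\<close>

definition lists_family :: "nat set list \<Rightarrow> nat set set \<Rightarrow> bool" where
  "lists_family As S \<longleftrightarrow> distinct As \<and> set As = S"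

definition incidence_rows :: "nat \<Rightarrow> nat set list \<Rightarrow> nat list" where
  "incidence_rows n As = concat (map (\<lambda>A. map (\<lambda>i. if i \<in> A then 1 else 0) [1..<Suc n]) As)"

definition encode1 :: "nat \<Rightarrow> nat set list \<Rightarrow> nat list" where
  "encode1 n As = [n, length As] @ incidence_rows n As"

definition encode2 :: "nat \<Rightarrow> nat set list \<Rightarrow> nat set list \<Rightarrow> nat list" where
  "encode2 n As Bs = [n, length As, length Bs] @ incidence_rows n As @ incidence_rows n Bs"

definition double_index :: "nat set list \<Rightarrow> (nat set + nat set) list" where
  "double_index As = map Inl As @ map Inr As"


section \<open>Polynomial-time equivalence of the two optimization problems\<close>

text \<open>
  Maximizing \<open>f\<close> over \<open>E\<close> and minimizing \<open>h\<close> over \<open>I\<close> are the same problem: \<open>g\<close> maps \<open>E\<close> onto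
  \<open>I\<close>, the optimal solutions correspond under \<open>g\<close>, and the optimal values differ by sign and
  the shift \<open>b\<close>.
\<close>

definition same_optimum ::
  "('x \<Rightarrow> 'y) \<Rightarrow> 'x set \<Rightarrow> ('x \<Rightarrow> real) \<Rightarrow> 'y set \<Rightarrow> ('y \<Rightarrow> real) \<Rightarrow> real \<Rightarrow> bool" where
  "same_optimum g E f I h b \<longleftrightarrow>
     g ` E = I \<and>
     (\<forall>x\<in>E. is_arg_max f (\<lambda>x. x \<in> E) x \<longleftrightarrow> is_arg_min h (\<lambda>y. y \<in> I) (g x)) \<and>
     Max (f ` E) = b - Min (h ` I)"

text \<open>
  None of the programs receives \<open>\<D>\<close>. The solution map \<open>g\<close> sends an indicator vector to the
  corresponding vertex.
\<close>

definition computes_solution_map ::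
  "prog \<Rightarrow> nat poly \<Rightarrow> nat \<Rightarrow> nat set set \<Rightarrow> nat set set
    \<Rightarrow> ((nat \<Rightarrow> real) \<Rightarrow> nat set + nat set \<Rightarrow> real) \<Rightarrow> bool" where
  "computes_solution_map G p n \<D> S g \<longleftrightarrow>
     (\<forall>As. lists_family As S \<longrightarrow>
       (\<forall>x\<in>set_system \<D>.
          computes_within G (poly p n) (encode1 n As) (map x [1..<Suc n])
            (map (g x) (double_index As))))"

text \<open>
  \<open>F\<close> turns a weight vector \<open>w\<close> of the defender oracle problem for \<open>S\<close> into a weight vector
  \<open>w'\<close> of the pseudo-Boolean problem with monomials indexed by \<open>T\<close>.
\<close>

definition oracle_to_pseudo_boolean ::
  "prog \<Rightarrow> nat poly \<Rightarrow> nat \<Rightarrow> nat set set \<Rightarrow> nat set set \<Rightarrow> nat set set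
    \<Rightarrow> ((nat \<Rightarrow> real) \<Rightarrow> nat set + nat set \<Rightarrow> real) \<Rightarrow> bool" where
  "oracle_to_pseudo_boolean F p n \<D> S T g \<longleftrightarrow>
     (\<forall>As Bs. lists_family As S \<longrightarrow> lists_family Bs T \<longrightarrow>
       (\<forall>w. \<exists>w' b.
          computes_within F (poly p n) (encode2 n As Bs) (map w (double_index As))
            (map w' Bs @ [b]) \<and>
          same_optimum g (set_system \<D>) (pseudo_boolean T w')
            (defender_vertices n \<D> S) (oracle_objective S w) b))"

definition pseudo_boolean_to_oracle ::
  "prog \<Rightarrow> nat poly \<Rightarrow> nat \<Rightarrow> nat set set \<Rightarrow> nat set set
    \<Rightarrow> ((nat \<Rightarrow> real) \<Rightarrow> nat set + nat set \<Rightarrow> real) \<Rightarrow> bool" where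
  "pseudo_boolean_to_oracle F p n \<D> S g \<longleftrightarrow>
     (\<forall>As. lists_family As S \<longrightarrow>
       (\<forall>w. \<exists>w' b.
          computes_within F (poly p n) (encode1 n As) (map w As)
            (map w' (double_index As) @ [b]) \<and>
          same_optimum g (set_system \<D>) (pseudo_boolean S w)
            (defender_vertices n \<D> S) (oracle_objective S w') b))"

text \<open>
  The monomial expansion of \<open>\<Prod>i\<in>A. (1 - x i)\<close> runs over all subsets of \<open>A\<close>, so the
  monomials of \<open>S\<close> alone suffice for the oracle problem when \<open>S\<close> contains the nonempty subsets
  of its members, that is, \<open>subset_hull S = S\<close> (the empty subset only contributes a constant).
  Otherwise they need not: for \<open>S = {{1,2}}\<close> and \<open>\<D> = {{}, {1}}\<close> every pseudo-Boolean function over \<open>S\<close>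
  vanishes on the set system, whereas \<open>defender_vertices\<close> has two elements.
\<close>

definition subset_hull :: "nat set set \<Rightarrow> nat set set" where
  "subset_hull S = S \<union> {V. V \<noteq> {} \<and> (\<exists>A\<in>S. V \<subseteq> A)}"

end

theory Submission
  imports Defs
begin

text \<open>
  On the set system, the coordinates of the vertex belonging to \<open>D\<close> are the monomials
  \<open>\<Prod>i\<in>A. 1 - x i\<close> and \<open>\<Prod>i\<in>A. x i\<close> at the indicator vector \<open>x\<close> of \<open>D\<close>. These points are
  0/1 vectors, so each of them is extreme in their convex hull. Expanding
  \<open>\<Prod>i\<in>A. 1 - x i = (\<Sum>V\<in>Pow A. (- 1) ^ card V * (\<Prod>i\<in>V. x i))\<close> turns an oracle objective into a
  pseudo-Boolean function on the nonempty subsets of members of \<open>S\<close>, up to a constant; the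
  converse uses only the \<open>K\<close>-block, with zero weights on the \<open>J\<close>-block. Since \<open>S\<close> has at most
  \<open>(n + 1) ^ c\<close> members, looping over pairs of members and over targets takes polynomial time; each
  coefficient is a product over the targets of polynomials in incidence bits, so the loop
  bodies need no branching.
\<close>

section \<open>Vertices and objectives\<close>

text \<open>Written with monomials in \<open>x\<close> instead of with the matrices, so that
  \<open>S\<close> and the vector alone determine the value; a program that is never given
  \<open>\<D>\<close> can then compute it.\<close>

definition vertex_map :: "nat set set \<Rightarrow> (nat \<Rightarrow> real) \<Rightarrow> nat set + nat set \<Rightarrow> real" where
  "vertex_map S x = proj_pair S (\<lambda>A. \<Prod>i\<in>A. 1 - x i) (\<lambda>A. \<Prod>i\<in>A. x i)"

lemma matK_eq_prod: "finite A \<Longrightarrow> matK A D = (\<Prod>i\<in>A. indicator D i)"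
  unfolding matK_def by (auto simp: indicator_def subset_iff)

lemma matJ_eq_prod: "A \<subseteq> {1..n} \<Longrightarrow> matJ n A D = (\<Prod>i\<in>A. 1 - indicator D i)"
proof -
  assume A: "A \<subseteq> {1..n}"
  then have "finite A" using finite_subset by blast
  \<comment> \<open>The entry of \<open>J\<close> at \<open>D\<close> is the entry of
    \<open>K\<close> at the complement \<open>{1..n} - D\<close>.\<close>
  with A have "matJ n A D = (\<Prod>i\<in>A. indicator ({1..n} - D) i)"
    using matK_eq_prod[of A "{1..n} - D"] by (simp add: matJ_def matK_def)
  also have "\<dots> = (\<Prod>i\<in>A. 1 - indicator D i)"
    using A by (intro prod.cong) (auto simp: indicator_def)
  finally show ?thesis .
qed

text \<open>In the multiplied-out product, \<open>V\<close> collects the factors from which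
  \<open>- x i\<close> rather than 1 is taken.\<close>

lemma prod_one_minus_expand:
  fixes x :: "'a \<Rightarrow> real"
  assumes "finite A"
  shows "(\<Prod>i\<in>A. 1 - x i) = (\<Sum>V\<in>Pow A. (- 1) ^ card V * (\<Prod>i\<in>V. x i))"
proof -
  have "(\<Prod>i\<in>A. 1 - x i) = (\<Prod>i\<in>A. - x i + 1)" by simp
  also have "\<dots> = (\<Sum>V\<in>Pow A. (\<Prod>i\<in>V. - x i) * (\<Prod>i\<in>A - V. 1))"
    by (rule prod_add) (fact assms)
  finally show ?thesis by (simp add: prod_uminus)
qed

section \<open>Extreme points of the convex hull of 0/1 vectors\<close>

text \<open>An extreme mixture coincides with any point \<open>v e\<close> of positive weight, for
  otherwise it would lie strictly between \<open>v e\<close> and the normalized rest. Conversely, 0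
  and 1 are extreme in the unit interval, which is applied to each coordinate. The family
  \<open>v\<close> may repeat points, as happens when \<open>S\<close> does not separate two
  defender sets.\<close>

lemma vertices_convex_hull:
  fixes v :: "'d \<Rightarrow> 'i \<Rightarrow> real"
  assumes fin: "finite I" and bin: "\<And>d i. d \<in> I \<Longrightarrow> v d i \<in> {0, 1}"
  shows "vertices {(\<lambda>i. \<Sum>d\<in>I. v d i * q d) | q. (\<forall>d\<in>I. 0 \<le> q d) \<and> (\<Sum>d\<in>I. q d) = 1} = v ` I"
    (is "vertices ?H = _")
proof (intro equalityI subsetI)
  fix x assume "x \<in> vertices ?H"
  then have ext: "\<And>y z t. y \<in> ?H \<Longrightarrow> z \<in> ?H \<Longrightarrow> 0 < t \<Longrightarrow> t < 1 \<Longrightarrow>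
      x = (\<lambda>i. (1 - t) * y i + t * z i) \<Longrightarrow> y = z"
    and "x \<in> ?H" unfolding vertices_def by blast+
  then obtain q where x: "x = (\<lambda>i. \<Sum>d\<in>I. v d i * q d)"
    and q: "\<forall>d\<in>I. 0 \<le> q d" "(\<Sum>d\<in>I. q d) = 1" by blast
  obtain e where e: "e \<in> I" "q e \<noteq> 0"
    using q(2) by (metis sum.neutral zero_neq_one)
  then have pos: "0 < q e" using q(1) by force
  have split: "(\<Sum>d\<in>I. h d) = h e + (\<Sum>d\<in>I - {e}. h d)" for h :: "'d \<Rightarrow> real"
    using fin e(1) by (rule sum.remove)
  have rest: "(\<Sum>d\<in>I - {e}. q d) = 1 - q e"
    using split[of q] q(2) by simp
  have unit: "v e \<in> ?H"
  proof -
    have "v e = (\<lambda>i. \<Sum>d\<in>I. v d i * (if d = e then 1 else 0))"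
      using fin e(1) by (simp add: sum.delta if_distrib cong: if_cong)
    moreover have "(\<Sum>d\<in>I. if d = e then 1 else (0::real)) = 1"
      using fin e(1) by (simp add: sum.delta)
    ultimately show ?thesis
      by (intro CollectI exI[of _ "\<lambda>d. if d = e then 1 else 0"]) simp
  qed
  show "x \<in> v ` I"
  proof (cases "q e = 1")
    case True
    then have "\<forall>d\<in>I - {e}. q d = 0"
      using rest fin q(1) sum_nonneg_eq_0_iff[of "I - {e}" q] by simp
    then have "x = v e" unfolding x using True by (subst split) simp
    then show ?thesis using e(1) by blast
  next
    case False
    have "0 \<le> 1 - q e" unfolding rest[symmetric] using q(1) by (intro sum_nonneg) auto
    with False have lt: "q e < 1" by simp
    \<comment> \<open>\<open>r\<close> is \<open>q\<close> conditioned on the indices other than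
      \<open>e\<close>, whose total weight is \<open>1 - q e\<close>.\<close>
    define r where "r d = (if d = e then 0 else q d / (1 - q e))" for d
    define y where "y = (\<lambda>i. \<Sum>d\<in>I. v d i * r d)"
    have r: "(\<Sum>d\<in>I. h d * r d) = (\<Sum>d\<in>I - {e}. h d * q d) / (1 - q e)" for h :: "'d \<Rightarrow> real"
      by (subst split) (simp add: r_def sum_divide_distrib)
    have "\<forall>d\<in>I. 0 \<le> r d" using q(1) lt by (simp add: r_def)
    moreover have "(\<Sum>d\<in>I. r d) = 1"
      using r[of "\<lambda>_. 1"] rest lt by simp
    ultimately have "y \<in> ?H" unfolding y_def by blast
    moreover have "x = (\<lambda>i. (1 - q e) * y i + q e * v e i)"
      unfolding x y_def r using lt by (subst split) (simp add: mult.commute add.commute)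
    ultimately have "y = v e" using ext unit pos lt by blast
    then have "x = v e"
      using \<open>x = (\<lambda>i. (1 - q e) * y i + q e * v e i)\<close> by (simp add: algebra_simps)
    then show ?thesis using e(1) by blast
  qed
next
  have range: "0 \<le> y i \<and> y i \<le> 1" if H: "y \<in> ?H" for y i
  proof -
    obtain q where y: "y = (\<lambda>i. \<Sum>d\<in>I. v d i * q d)"
      and q: "\<forall>d\<in>I. 0 \<le> q d" "(\<Sum>d\<in>I. q d) = 1" using H by blast
    have "0 \<le> v d i \<and> v d i \<le> 1" if "d \<in> I" for d
      using bin[OF that, of i] by auto
    then have "0 \<le> v d i * q d \<and> v d i * q d \<le> q d" if "d \<in> I" for d
      using that q(1) by (simp add: mult_left_le_one_le)
    then have "0 \<le> y i" "y i \<le> (\<Sum>d\<in>I. q d)"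
      unfolding y by (auto intro!: sum_nonneg sum_mono)
    then show ?thesis using q(2) by simp
  qed
  fix x assume "x \<in> v ` I"
  then obtain e where e: "e \<in> I" "x = v e" by blast
  have "v e = (\<lambda>i. \<Sum>d\<in>I. v d i * (if d = e then 1 else 0))"
    using fin e(1) by (simp add: sum.delta if_distrib cong: if_cong)
  moreover have "(\<Sum>d\<in>I. if d = e then 1 else (0::real)) = 1"
    using fin e(1) by (simp add: sum.delta)
  ultimately have "x \<in> ?H" unfolding e(2)
    by (intro CollectI exI[of _ "\<lambda>d. if d = e then 1 else 0"]) simp
  moreover have "y = z" if y: "y \<in> ?H" and z: "z \<in> ?H" and t: "0 < t" "t < 1"
    and eq: "x = (\<lambda>i. (1 - t) * y i + t * z i)" for y z t
  proof
    fix i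
    note yz = range[OF y, of i] range[OF z, of i]
    have "v e i = (1 - t) * y i + t * z i" using fun_cong[OF eq, of i] e(2) by simp
    moreover have "v e i = 0 \<or> v e i = 1" using bin[OF e(1), of i] by simp
    moreover have "y i = z i" if "(1 - t) * y i + t * z i = 0"
    proof -
      have "0 \<le> (1 - t) * y i" "0 \<le> t * z i" using yz t by auto
      then have "(1 - t) * y i = 0" "t * z i = 0" using that by linarith+
      then show ?thesis using t by simp
    qed
    \<comment> \<open>The case of value 0 again, now for \<open>1 - y i\<close> and
      \<open>1 - z i\<close>.\<close>
    moreover have "y i = z i" if "(1 - t) * y i + t * z i = 1"
    proof -
      have "0 \<le> (1 - t) * (1 - y i)" "0 \<le> t * (1 - z i)" using yz t by auto
      moreover have "(1 - t) * (1 - y i) + t * (1 - z i) = 0"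
        using that by (simp add: algebra_simps)
      ultimately have "(1 - t) * (1 - y i) = 0" "t * (1 - z i) = 0" by linarith+
      then show ?thesis using t by simp
    qed
    ultimately show "y i = z i" by metis
  qed
  ultimately show "x \<in> vertices ?H" unfolding vertices_def by blast
qed

text \<open>The polytope is the convex hull of the columns of \<open>J\<close> stacked on
  \<open>K\<close>, restricted to \<open>S\<close>. These columns are 0/1 vectors, so each of them
  is a vertex.\<close>

lemma defender_vertices_eq:
  assumes D: "\<D> \<subseteq> Pow {1..n}" and S: "S \<subseteq> Pow {1..n}"
  shows "defender_vertices n \<D> S = vertex_map S ` set_system \<D>"
proof -
  have fin: "finite \<D>" using D finite_subset by blast
  have finS: "finite A" if "A \<in> S" for A using that S finite_subset by blast
  have bin: "vertex_map S (indicator D) i \<in> {0, 1}" for D i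
    using S finS unfolding vertex_map_def proj_pair_def
    by (auto split: sum.split simp: matJ_eq_prod[symmetric, where n = n]
          matK_eq_prod[symmetric] matJ_def matK_def subset_iff)
  have "proj_pair S (\<lambda>A. \<Sum>D\<in>\<D>. matJ n A D * q D) (\<lambda>A. \<Sum>D\<in>\<D>. matK A D * q D) =
      (\<lambda>i. \<Sum>D\<in>\<D>. vertex_map S (indicator D) i * q D)" for q
  proof
    fix i
    show "proj_pair S (\<lambda>A. \<Sum>D\<in>\<D>. matJ n A D * q D) (\<lambda>A. \<Sum>D\<in>\<D>. matK A D * q D) i =
      (\<Sum>D\<in>\<D>. vertex_map S (indicator D) i * q D)"
    proof (cases i)
      case (Inl A)
      then show ?thesis
        using matJ_eq_prod[of A n] S by (auto simp: proj_pair_def vertex_map_def intro!: sum.cong)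
    next
      case (Inr A)
      then show ?thesis
        using matK_eq_prod[of A] finS by (auto simp: proj_pair_def vertex_map_def intro!: sum.cong)
    qed
  qed
  then have "defender_vertices n \<D> S =
      vertices {(\<lambda>i. \<Sum>D\<in>\<D>. vertex_map S (indicator D) i * q D) | q.
        (\<forall>D\<in>\<D>. 0 \<le> q D) \<and> (\<Sum>D\<in>\<D>. q D) = 1}"
    unfolding defender_vertices_def defender_polytope_def mixed_strategies_def by simp
  also have "\<dots> = (\<lambda>D. vertex_map S (indicator D)) ` \<D>"
    by (rule vertices_convex_hull[OF fin bin])
  finally show ?thesis unfolding set_system_def by (simp add: image_image)
qed

section \<open>Oracle objectives as pseudo-Boolean functions\<close>

lemma oracle_objective_vertex_map:
  assumes "finite S"
  shows "oracle_objective S w (vertex_map S x) =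
    (\<Sum>A\<in>S. w (Inl A) * (\<Prod>i\<in>A. 1 - x i)) + (\<Sum>A\<in>S. w (Inr A) * (\<Prod>i\<in>A. x i))"
  unfolding oracle_objective_def using assms
  by (subst sum.Plus) (auto simp: vertex_map_def proj_pair_def)

text \<open>These are the coefficients of the negated objective, the negation exchanging minimum and
  maximum. The constant term of the \<open>J\<close> part is left out and goes into the
  shift.\<close>

definition pseudo_boolean_weights ::
  "nat set set \<Rightarrow> (nat set + nat set \<Rightarrow> real) \<Rightarrow> nat set \<Rightarrow> real" where
  "pseudo_boolean_weights S w V =
     - (\<Sum>A\<in>S. (if V \<noteq> {} \<and> V \<subseteq> A then (- 1) ^ card V else 0) * w (Inl A) +
               (if V = A then 1 else 0) * w (Inr A))"

text \<open>After exchanging the two sums, each \<open>A\<close> contributes its expanded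
  \<open>J\<close> monomial minus 1 and its own \<open>K\<close> monomial; the subtracted 1s add up
  to the shift.\<close>

lemma pseudo_boolean_weights_correct:
  assumes S: "S \<subseteq> Pow {1..n}"
  shows "pseudo_boolean (subset_hull S) (pseudo_boolean_weights S w) x =
    (\<Sum>A\<in>S. w (Inl A)) - oracle_objective S w (vertex_map S x)"
proof -
  let ?T = "subset_hull S"
  let ?m = "\<lambda>V. \<Prod>i\<in>V. x i"
  have finA: "finite A" if "A \<in> S" for A
    using S that by (auto intro: finite_subset)
  have fin: "finite S" using S finite_subset by blast
  have "?T \<subseteq> Pow {1..n}" using S unfolding subset_hull_def by blast
  then have finT: "finite ?T" using finite_subset by blast
  have A1: "(\<Sum>V\<in>?T. (if V \<noteq> {} \<and> V \<subseteq> A then (- 1) ^ card V else 0) * ?m V) =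
      (\<Prod>i\<in>A. 1 - x i) - 1" if A: "A \<in> S" for A
  proof -
    have "(\<Sum>V\<in>?T. (if V \<noteq> {} \<and> V \<subseteq> A then (- 1) ^ card V else 0) * ?m V) =
        (\<Sum>V\<in>Pow A - {{}}. (- 1) ^ card V * ?m V)"
      using finT A by (intro sum.mono_neutral_cong_right) (auto simp: subset_hull_def)
    \<comment> \<open>The removed set \<open>{}\<close> would contribute the empty product
      1.\<close>
    also have "\<dots> = (\<Sum>V\<in>Pow A. (- 1) ^ card V * ?m V) - 1"
      using finA[OF A] by (subst sum_diff1) auto
    finally show ?thesis using prod_one_minus_expand[OF finA[OF A], of x] by simp
  qed
  have A2: "(\<Sum>V\<in>?T. (if V = A then 1 else 0) * ?m V) = ?m A" if "A \<in> S" for A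
  proof -
    have "A \<in> ?T" using that unfolding subset_hull_def by blast
    then show ?thesis using finT by (simp add: if_distrib[of "\<lambda>r. r * _"] sum.delta cong: if_cong)
  qed
  have "pseudo_boolean ?T (pseudo_boolean_weights S w) x =
      - (\<Sum>A\<in>S. w (Inl A) * (\<Sum>V\<in>?T. (if V \<noteq> {} \<and> V \<subseteq> A then (- 1) ^ card V else 0) * ?m V)
            + w (Inr A) * (\<Sum>V\<in>?T. (if V = A then 1 else 0) * ?m V))"
    unfolding pseudo_boolean_def pseudo_boolean_weights_def
    by (simp add: sum_distrib_right sum_distrib_left sum_negf[symmetric] sum.distrib[symmetric])
       (subst sum.swap, simp add: algebra_simps)
  also have "\<dots> = - (\<Sum>A\<in>S. w (Inl A) * ((\<Prod>i\<in>A. 1 - x i) - 1) + w (Inr A) * ?m A)"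
    using A1 A2 by simp
  also have "\<dots> = (\<Sum>A\<in>S. w (Inl A)) - oracle_objective S w (vertex_map S x)"
    unfolding oracle_objective_vertex_map[OF fin]
    by (simp add: sum.distrib sum_subtractf algebra_simps)
  finally show ?thesis .
qed

text \<open>The relation between \<open>f\<close> and \<open>h\<close> reverses the order of values,
  and surjectivity of \<open>g\<close> makes every competitor in \<open>I\<close> come from
  \<open>E\<close>. Points with a common image have the same value of \<open>f\<close>, so
  \<open>g\<close> may identify them.\<close>

lemma same_optimumI:
  assumes fin: "finite E" "E \<noteq> {}" and I: "g ` E = I"
    and fh: "\<And>x. x \<in> E \<Longrightarrow> f x = b - h (g x)"
  shows "same_optimum g E f I h b"
proof -
  have "is_arg_max f (\<lambda>x. x \<in> E) x \<longleftrightarrow> is_arg_min h (\<lambda>y. y \<in> I) (g x)" if "x \<in> E" for x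
    unfolding is_arg_max_def is_arg_min_def I[symmetric] using that fh by force
  moreover have "Max (f ` E) = b - Min (h ` I)"
  proof (rule Max_eqI)
    show "finite (f ` E)" using fin by simp
    have hI: "finite (h ` I)" "h ` I \<noteq> {}" using fin I by auto
    show "y \<le> b - Min (h ` I)" if "y \<in> f ` E" for y
      using that fh I hI by auto
    obtain x where "x \<in> E" "Min (h ` I) = h (g x)"
      using Min_in[OF hI] I by auto
    then show "b - Min (h ` I) \<in> f ` E" using fh by force
  qed
  ultimately show ?thesis unfolding same_optimum_def using I by blast
qed

section \<open>Number of attack sets\<close>

text \<open>Every attack set is spelled by a word of length exactly \<open>c\<close> over
  \<open>{0..n}\<close>: shorter lists are padded with 0, which is not a target and is removed again
  by \<open>- {0}\<close>.\<close>

lemma card_attacks_le: "card (attacks n c) \<le> (n + 1) ^ c"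
proof -
  let ?L = "{xs. set xs \<subseteq> {0..n} \<and> length xs = c}"
  have "attacks n c \<subseteq> (\<lambda>xs. set xs - {0}) ` ?L"
  proof
    fix A assume "A \<in> attacks n c"
    then have A: "A \<subseteq> {1..n}" "card A \<le> c" unfolding attacks_def by auto
    then have "finite A" using finite_subset by blast
    then obtain xs where xs: "set xs = A" "distinct xs"
      using finite_distinct_list by blast
    with A have "length xs \<le> c" by (metis distinct_card)
    moreover have "A = set (xs @ replicate (c - length xs) 0) - {0}"
      using xs A(1) by auto
    moreover have "set (xs @ replicate (c - length xs) 0) \<subseteq> {0..n}"
      using xs A(1) by auto
    ultimately show "A \<in> (\<lambda>xs. set xs - {0}) ` ?L"
      by (intro image_eqI[of _ _ "xs @ replicate (c - length xs) 0"]) auto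
  qed
  moreover have "finite ?L" by (rule finite_lists_length_eq) simp
  ultimately have "card (attacks n c) \<le> card ?L" using surj_card_le by blast
  then show ?thesis by (simp add: card_lists_length_eq)
qed

section \<open>Timed Hoare rules\<close>

text \<open>A total-correctness triple at a fixed initial state. \<open>T\<close> is only an upper
  bound, so branches of different length can share it although \<open>exec\<close> counts
  exactly.\<close>

definition runs ::
  "prog \<Rightarrow> (nat \<Rightarrow> nat) \<Rightarrow> (nat \<Rightarrow> real) \<Rightarrow> nat \<Rightarrow> ((nat \<Rightarrow> nat) \<Rightarrow> (nat \<Rightarrow> real) \<Rightarrow> bool) \<Rightarrow> bool" where
  "runs P f g T Q \<longleftrightarrow> (\<exists>t f' g'. t \<le> T \<and> exec P (f, g) t (f', g') \<and> Q f' g')"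

lemma runs_mono:
  assumes "runs P f g T Q" "T \<le> T'" "\<And>f g. Q f g \<Longrightarrow> Q' f g"
  shows "runs P f g T' Q'"
  using assms unfolding runs_def by (meson le_trans)

lemma runs_Skip: "Q f g \<Longrightarrow> runs Skip f g 1 Q"
  unfolding runs_def by (meson exec_Skip le_refl)

lemma runs_NStore: "Q (f(nval a (f, g) := nval b (f, g))) g \<Longrightarrow> runs (NStore a b) f g 1 Q"
  unfolding runs_def using exec_NStore[of a b "(f, g)"] by auto

lemma runs_RStore: "Q f (g(nval a (f, g) := rval r (f, g))) \<Longrightarrow> runs (RStore a r) f g 1 Q"
  unfolding runs_def using exec_RStore[of a r "(f, g)"] by auto

lemma runs_Seq:
  assumes "runs P f g T1 R" "\<And>f g. R f g \<Longrightarrow> runs P' f g T2 Q"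
  shows "runs (Seq P P') f g (T1 + T2) Q"
  using assms unfolding runs_def by (meson exec_Seq add_mono)

text \<open>The intermediate assertion is the triple of the second program itself, so backward
  application leaves no assertion to invent.\<close>

lemma runs_Seq_wp:
  assumes "runs P f g T1 (\<lambda>f g. runs P' f g T2 Q)"
  shows "runs (Seq P P') f g (T1 + T2) Q"
  using assms by (rule runs_Seq)

lemma runs_Cond:
  assumes "tval b (f, g) \<Longrightarrow> runs P f g T Q" "\<not> tval b (f, g) \<Longrightarrow> runs P' f g T Q"
  shows "runs (Cond b P P') f g (1 + T) Q"
  using assms unfolding runs_def by (meson exec_CondT exec_CondF add_left_mono)

text \<open>Induction on the number \<open>k - i\<close> of remaining rounds. A round costs the body
  and one successful test; the last 1 is the failing test.\<close>

lemma runs_Loop: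
  assumes "J i f g" "i \<le> k"
    and step: "\<And>i f g. i < k \<Longrightarrow> J i f g \<Longrightarrow> tval b (f, g) \<and> runs P f g T (J (Suc i))"
    and exit: "\<And>f g. J k f g \<Longrightarrow> \<not> tval b (f, g)"
  shows "runs (Loop b P) f g ((k - i) * (T + 1) + 1) (J k)"
  using assms(1,2)
proof (induction "k - i" arbitrary: i f g)
  case 0
  then have "J k f g" by simp
  then show ?case
    unfolding runs_def using exec_LoopF exit by (metis le_add2)
next
  case (Suc d)
  then have "i < k" by simp
  from step[OF this Suc.prems(1)] obtain t f' g' where
    b: "tval b (f, g)" and t: "t \<le> T" "exec P (f, g) t (f', g')" "J (Suc i) f' g'"
    unfolding runs_def by blast
  have "runs (Loop b P) f' g' ((k - Suc i) * (T + 1) + 1) (J k)"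
    using Suc t \<open>i < k\<close> by simp
  then obtain t2 f2 g2 where
    t2: "t2 \<le> (k - Suc i) * (T + 1) + 1" "exec (Loop b P) (f', g') t2 (f2, g2)" "J k f2 g2"
    unfolding runs_def by blast
  have "k - i = Suc (k - Suc i)" using \<open>i < k\<close> by simp
  then have "1 + t + t2 \<le> (k - i) * (T + 1) + 1"
    using t(1) t2(1) by simp
  then show ?case
    unfolding runs_def using exec_LoopT[OF b t(2) t2(2)] t2(3) by blast
qed

abbreviation reg :: "nat \<Rightarrow> nexp" where
  "reg r \<equiv> NLoad (NConst r)"

definition For :: "nat \<Rightarrow> nexp \<Rightarrow> prog \<Rightarrow> prog" where
  "For r e P = Seq (NStore (NConst r) (NConst 0))
     (Loop (NLess (reg r) e) (Seq P (NStore (NConst r) (NAdd (reg r) (NConst 1)))))"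

text \<open>The limit \<open>e\<close> is evaluated anew at each test, hence \<open>bound\<close>.
  The body has to preserve the counter, and \<open>J\<close> is demanded for the memory as it will
  be after the increment. The leading 2 pays for initialization and failing test, the 2 added to
  \<open>T\<close> for successful test and increment.\<close>

lemma runs_For:
  assumes init: "J 0 (f(r := 0)) g"
    and bound: "\<And>i f g. i \<le> k \<Longrightarrow> J i f g \<Longrightarrow> f r = i \<Longrightarrow> nval e (f, g) = k"
    and step: "\<And>i f g. i < k \<Longrightarrow> J i f g \<Longrightarrow> f r = i \<Longrightarrow>
      runs P f g T (\<lambda>f' g'. f' r = i \<and> J (Suc i) (f'(r := Suc i)) g')"
    and post: "\<And>f g. J k f g \<Longrightarrow> f r = k \<Longrightarrow> Q f g"
  shows "runs (For r e P) f g (2 + k * (T + 2)) Q"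
proof -
  let ?J = "\<lambda>i f g. J i f g \<and> f r = i"
  let ?body = "Seq P (NStore (NConst r) (NAdd (reg r) (NConst 1)))"
  have start: "?J 0 (f(r := 0)) g"
    by (simp only: init fun_upd_same simp_thms)
  have loop: "runs (Loop (NLess (reg r) e) ?body) (f(r := 0)) g ((k - 0) * ((T + 1) + 1) + 1) (?J k)"
  proof (rule runs_Loop[where J = ?J])
    show "?J 0 (f(r := 0)) g" by (fact start)
  next
    fix i f g assume i: "i < k" "J i f g \<and> f r = i"
    then have "tval (NLess (reg r) e) (f, g)"
      using bound[of i f g] by simp
    moreover have "runs ?body f g (T + 1) (?J (Suc i))"
    proof (rule runs_Seq[where R = "\<lambda>f' g'. f' r = i \<and> J (Suc i) (f'(r := Suc i)) g'"])
      show "runs P f g T (\<lambda>f' g'. f' r = i \<and> J (Suc i) (f'(r := Suc i)) g')"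
        using step i by blast
      fix f' g' assume "f' r = i \<and> J (Suc i) (f'(r := Suc i)) g'"
      then show "runs (NStore (NConst r) (NAdd (reg r) (NConst 1))) f' g' 1 (?J (Suc i))"
        by (intro runs_NStore) simp
    qed
    ultimately show "tval (NLess (reg r) e) (f, g) \<and> runs ?body f g (T + 1) (?J (Suc i))"
      by blast
  next
    fix f g assume "J k f g \<and> f r = k"
    then show "\<not> tval (NLess (reg r) e) (f, g)"
      using bound[of k f g] by simp
  qed simp
  have "runs (For r e P) f g (1 + ((k - 0) * ((T + 1) + 1) + 1)) (?J k)"
    unfolding For_def
  proof (rule runs_Seq[where R = "\<lambda>f' g'. f' = f(r := 0) \<and> g' = g"])
    show "runs (NStore (NConst r) (NConst 0)) f g 1 (\<lambda>f' g'. f' = f(r := 0) \<and> g' = g)"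
      by (rule runs_NStore) simp
  qed (use loop in blast)
  moreover have "1 + ((k - 0) * ((T + 1) + 1) + 1) \<le> 2 + k * (T + 2)" by simp
  moreover have "Q f g" if "J k f g \<and> f r = k" for f g
    using that post by blast
  ultimately show ?thesis by (rule runs_mono)
qed

lemma computes_within_runs:
  assumes "runs P (fst (initial ns rs)) (snd (initial ns rs)) T0 (\<lambda>f g. \<forall>k<length out. g k = out ! k)"
    "T0 \<le> T"
  shows "computes_within P T ns rs out"
  using assms unfolding runs_def computes_within_def by (metis le_trans prod.collapse snd_conv)

section \<open>The programs\<close>

text \<open>Register conventions: 0 holds \<open>n\<close>; 1 and, for a second family, 2 hold
  numbers of rows; 3 is the innermost counter; 4 and 5 are the addresses read by \<open>rowA\<close>
  and \<open>rowB\<close>; 6 and 7 count rows.\<close>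

definition prod_loop :: "nexp \<Rightarrow> rexp \<Rightarrow> prog" where
  "prod_loop dst e = Seq (RStore dst (RConst 1)) (For 3 (reg 0) (RStore dst (RMul (RLoad dst) e)))"

text \<open>The premise \<open>e\<close> ranges over all contents \<open>y\<close> of the
  accumulator, because cell \<open>d\<close> holds a different partial product in each
  round.\<close>

lemma runs_prod_loop:
  assumes n: "f 0 = n"
    and dst: "\<And>i g'. nval dst (f(3 := i), g') = d"
    and e: "\<And>i y. i < n \<Longrightarrow> rval e (f(3 := i), g(d := y)) = \<phi> i"
    and Q: "Q (f(3 := n)) (g(d := \<Prod>i<n. \<phi> i))"
  shows "runs (prod_loop dst e) f g (1 + (2 + n * (1 + 2))) Q"
  unfolding prod_loop_def
proof (intro runs_Seq_wp runs_RStore)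
  have "nval dst (f, g) = d" using dst[of "f 3" g] by simp
  moreover have "runs (For 3 (reg 0) (RStore dst (RMul (RLoad dst) e))) f (g(d := 1)) (2 + n * (1 + 2)) Q"
  proof (rule runs_For[where J = "\<lambda>i f' g'. f' = f(3 := i) \<and> g' = g(d := \<Prod>j<i. \<phi> j)"])
    fix i f' g' assume i: "i < n" "f' = f(3 := i) \<and> g' = g(d := \<Prod>j<i. \<phi> j)"
    show "runs (RStore dst (RMul (RLoad dst) e)) f' g' 1 (\<lambda>f' g'. f' 3 = i \<and>
       f'(3 := Suc i) = f(3 := Suc i) \<and> g' = g(d := \<Prod>j<Suc i. \<phi> j))"
      by (rule runs_RStore) (use i dst e in simp)
  qed (use n Q in auto)
  ultimately show "runs (For 3 (reg 0) (RStore dst (RMul (RLoad dst) e))) f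
     (g(nval dst (f, g) := rval (RConst 1) (f, g))) (2 + n * (1 + 2)) Q"
    by simp
qed

definition copy_loop :: "nexp \<Rightarrow> nexp \<Rightarrow> prog" where
  "copy_loop src len = For 3 len (RStore (reg 3) (RLoad (NAdd src (reg 3))))"

text \<open>With \<open>k \<le> s\<close> the destination lies below the source block, so no source
  cell is overwritten before it is read.\<close>

lemma runs_copy_loop:
  assumes src: "\<And>i g'. nval src (f(3 := i), g') = s"
    and len: "\<And>i g'. nval len (f(3 := i), g') = k"
    and "k \<le> s"
    and Q: "Q (f(3 := k)) (\<lambda>j. if j < k then g (s + j) else g j)"
  shows "runs (copy_loop src len) f g (2 + k * (1 + 2)) Q"
  unfolding copy_loop_def
proof (rule runs_For[where J = "\<lambda>i f' g'. f' = f(3 := i) \<and> g' = (\<lambda>j. if j < i then g (s + j) else g j)"])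
  fix i f' g' assume i: "i < k" "f' = f(3 := i) \<and> g' = (\<lambda>j. if j < i then g (s + j) else g j)"
  show "runs (RStore (reg 3) (RLoad (NAdd src (reg 3)))) f' g' 1 (\<lambda>f' g'. f' 3 = i \<and>
     f'(3 := Suc i) = f(3 := Suc i) \<and> g' = (\<lambda>j. if j < Suc i then g (s + j) else g j))"
  proof (rule runs_RStore)
    have src': "nval src (f', g') = s" using i src by simp
    show "(f' 3 = i \<and> f'(3 := Suc i) = f(3 := Suc i) \<and>
      g'(nval (reg 3) (f', g') := rval (RLoad (NAdd src (reg 3))) (f', g')) =
        (\<lambda>j. if j < Suc i then g (s + j) else g j))"
      unfolding nval.simps rval.simps fst_conv snd_conv src' using i \<open>k \<le> s\<close>
      by (auto simp: fun_eq_iff less_Suc_eq)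
  qed
qed (use len Q in auto)

text \<open>
  The input matrix occupies the natural cells from \<open>h\<close> on. Its entries are bits, so they can be
  kept in the real memory, which frees the natural memory for registers: first the cells below
  \<open>11\<close> are saved without any loop variable, then they serve as registers for moving the rest.
\<close>

primrec save_cells :: "nat \<Rightarrow> nexp \<Rightarrow> nat \<Rightarrow> prog" where
  "save_cells h base 0 = Skip"
| "save_cells h base (Suc k) = Seq (save_cells h base k)
     (Cond (NLess (NConst 0) (reg (h + k))) (RStore (NAdd base (NConst k)) (RConst 1)) Skip)"

definition load_bits :: "nat \<Rightarrow> nexp \<Rightarrow> nexp \<Rightarrow> prog" where
  "load_bits h base rows =
     Seq (save_cells h base (11 - h))
    (Seq (NStore (NConst 8) (NConst 0))
    (Seq (For 3 rows (NStore (NConst 8) (NAdd (reg 8) (reg 0))))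
         (For 3 (reg 8) (Cond (NLess (NConst 0) (NLoad (NAdd (reg 3) (NConst 11))))
            (RStore (NAdd base (NAdd (reg 3) (NConst (11 - h)))) (RConst 1)) Skip))))"

text \<open>No expression turns a natural into a real, so a bit is transferred by a test that stores
  the constant 1. For a bit 0 nothing is written, which is right because the destination initially
  holds 0.\<close>

lemma runs_save_cells:
  assumes base: "\<And>g'. nval base (f, g') = b"
    and bits: "\<And>c. h \<le> c \<Longrightarrow> f c \<le> 1"
    and zero: "\<And>j. b \<le> j \<Longrightarrow> g j = 0"
  shows "runs (save_cells h base k) f g (1 + k * 2)
    (\<lambda>f' g'. f' = f \<and> g' = (\<lambda>j. if b \<le> j \<and> j < b + k then real (f (h + (j - b))) else g j))"
proof (induction k)
  case 0
  have "runs Skip f g 1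
    (\<lambda>f' g'. f' = f \<and> g' = (\<lambda>j. if b \<le> j \<and> j < b + 0 then real (f (h + (j - b))) else g j))"
    by (rule runs_Skip) auto
  then show ?case by simp
next
  case (Suc k)
  have "runs (save_cells h base (Suc k)) f g ((1 + k * 2) + (1 + 1))
    (\<lambda>f' g'. f' = f \<and> g' = (\<lambda>j. if b \<le> j \<and> j < b + Suc k then real (f (h + (j - b))) else g j))"
    unfolding save_cells.simps
  proof (rule runs_Seq[OF Suc.IH], rule runs_Cond, goal_cases)
    case (1 f' g')
    then have "nval base (f', g') = b" "f (h + k) = 1"
      using base bits[of "h + k"] by auto
    with 1 show ?case
      by (intro runs_RStore)
         (simp only: nval.simps rval.simps fst_conv snd_conv, auto simp: fun_eq_iff less_Suc_eq)
  next
    case (2 f' g')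
    then show ?case
      using zero[of "b + k"] by (intro runs_Skip) (auto simp: fun_eq_iff less_Suc_eq)
  qed
  then show ?case by simp
qed

text \<open>\<open>base\<close> and \<open>rows\<close> may depend on the \<open>h\<close> header
  cells only, since registers 3 and 8 are overwritten. As naturals cannot be multiplied, register 8
  receives \<open>r * n\<close> by repeated addition.\<close>

lemma runs_load_bits:
  assumes h: "0 < h" "h \<le> 3"
    and base: "\<And>f' g'. (\<And>c. c < h \<Longrightarrow> f' c = f c) \<Longrightarrow> nval base (f', g') = b"
    and rows: "\<And>f' g'. (\<And>c. c < h \<Longrightarrow> f' c = f c) \<Longrightarrow> nval rows (f', g') = r"
    and bits: "\<And>c. h \<le> c \<Longrightarrow> f c \<le> 1"
    and rest: "\<And>c. h + r * f 0 \<le> c \<Longrightarrow> f c = 0"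
    and zero: "\<And>j. b \<le> j \<Longrightarrow> g j = 0"
    and Q: "\<And>f' g'. (\<And>c. c < h \<Longrightarrow> f' c = f c) \<Longrightarrow>
      g' = (\<lambda>j. if j < b then g j else real (f (h + (j - b)))) \<Longrightarrow> Q f' g'"
  shows "runs (load_bits h base rows) f g (30 + 3 * r + 4 * (r * f 0)) Q"
proof -
  define n where "n = f 0"
  let ?g = "\<lambda>k j. if b \<le> j \<and> j < b + (11 - h) + k then real (f (h + (j - b))) else g j"
  have keep3: "f' c = f c" if "\<forall>c. c \<notin> {3, 8} \<longrightarrow> f' c = f c" "c < h" for f' :: "nat \<Rightarrow> nat" and c
    using that h by auto
  have "runs (load_bits h base rows) f g ((1 + (11 - h) * 2) + (1 + ((2 + r * (1 + 2)) + (2 + (r * n) * ((1 + 1) + 2))))) Q"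
    unfolding load_bits_def
  proof (rule runs_Seq[OF runs_save_cells[where b = b]])
    fix f1 g1
    assume 1: "f1 = f \<and> g1 = (\<lambda>j. if b \<le> j \<and> j < b + (11 - h) then real (f (h + (j - b))) else g j)"
    show "runs (Seq (NStore (NConst 8) (NConst 0))
         (Seq (For 3 rows (NStore (NConst 8) (NAdd (reg 8) (reg 0))))
         (For 3 (reg 8) (Cond (NLess (NConst 0) (NLoad (NAdd (reg 3) (NConst 11))))
            (RStore (NAdd base (NAdd (reg 3) (NConst (11 - h)))) (RConst 1)) Skip)))) f1 g1
            (1 + ((2 + r * (1 + 2)) + (2 + (r * n) * ((1 + 1) + 2)))) Q"
    proof (intro runs_Seq_wp runs_NStore)
      show "runs (For 3 rows (NStore (NConst 8) (NAdd (reg 8) (reg 0))))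
        (f1(nval (NConst 8) (f1, g1) := nval (NConst 0) (f1, g1))) g1 (2 + r * (1 + 2))
        (\<lambda>f g. runs (For 3 (reg 8) (Cond (NLess (NConst 0) (NLoad (NAdd (reg 3) (NConst 11))))
            (RStore (NAdd base (NAdd (reg 3) (NConst (11 - h)))) (RConst 1)) Skip)) f g
            (2 + (r * n) * ((1 + 1) + 2)) Q)"
      proof (rule runs_For[where J = "\<lambda>i f' g'. (\<forall>c. c \<notin> {3, 8} \<longrightarrow> f' c = f c) \<and>
          f' 8 = i * n \<and> g' = ?g 0"], goal_cases)
        case 1
        then show ?case using \<open>f1 = f \<and> _\<close> by simp
      next
        case (2 i f' g')
        then show ?case using rows keep3 by blast
      next
        case (3 i f' g')
        then show ?case by (intro runs_NStore) (auto simp: n_def)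
      next
        case (4 f2 g2)
        show ?case
        proof (rule runs_For[where J = "\<lambda>i f' g'. (\<forall>c. c \<notin> {3, 8} \<longrightarrow> f' c = f c) \<and>
          f' 8 = r * n \<and> g' = ?g i"], goal_cases)
          case 1
          then show ?case using 4 by simp
        next
          case (2 i f' g')
          then show ?case by simp
        next
          case (3 i f' g')
          then have b: "nval base (f', g') = b" using base keep3 by blast
          \<comment> \<open>Cell \<open>i + 11\<close> lies above both overwritten registers and
            still holds its input.\<close>
          have i: "f' (i + 11) = f (i + 11)" "f (i + 11) \<le> 1" "h + (11 - h + i) = i + 11"
            using 3 bits[of "i + 11"] h by auto
          show ?case
          proof (rule runs_Cond)
            assume "tval (NLess (NConst 0) (NLoad (NAdd (reg 3) (NConst 11)))) (f', g')"
            then have "f (i + 11) = 1" using i 3 by simp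
            then show "runs (RStore (NAdd base (NAdd (reg 3) (NConst (11 - h)))) (RConst 1)) f' g' 1
              (\<lambda>f' g'. f' 3 = i \<and> ((\<forall>c. c \<notin> {3, 8} \<longrightarrow> (f'(3 := Suc i)) c = f c) \<and>
               (f'(3 := Suc i)) 8 = r * n \<and> g' = ?g (Suc i)))"
              using 3 b i by (intro runs_RStore) (auto simp: fun_eq_iff less_Suc_eq)
          next
            assume "\<not> tval (NLess (NConst 0) (NLoad (NAdd (reg 3) (NConst 11)))) (f', g')"
            then have "f (i + 11) = 0" using i 3 by simp
            then show "runs Skip f' g' 1
              (\<lambda>f' g'. f' 3 = i \<and> ((\<forall>c. c \<notin> {3, 8} \<longrightarrow> (f'(3 := Suc i)) c = f c) \<and>
               (f'(3 := Suc i)) 8 = r * n \<and> g' = ?g (Suc i)))"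
              using 3 i
              by (intro runs_Skip) (auto simp: fun_eq_iff less_Suc_eq zero add.commute[of _ 11])
          qed
        next
          case (4 f' g')
          \<comment> \<open>The \<open>r * n\<close> rounds start at cell 11 and so may run past the
            end of the matrix; the cells there hold 0 and cause no write.\<close>
          have "?g (r * n) = (\<lambda>j. if j < b then g j else real (f (h + (j - b))))"
            using rest zero h unfolding n_def by (auto simp: fun_eq_iff)
          then show ?case using 4 Q[of f' g'] keep3[of f'] by simp
        qed
      qed
    qed
  qed (use base bits zero in auto)
  then show ?thesis
    by (rule runs_mono) (use h in \<open>auto simp: n_def\<close>)
qed

text \<open>Register 4 advances by \<open>n\<close> per row, which avoids a product of row number
  and \<open>n\<close>.\<close>

definition rows_loop :: "nexp \<Rightarrow> nexp \<Rightarrow> rexp \<Rightarrow> prog" where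
  "rows_loop dst base e = Seq (NStore (NConst 4) base)
     (For 6 (reg 1) (Seq (prod_loop (NAdd dst (reg 6)) e)
                         (NStore (NConst 4) (NAdd (reg 4) (reg 0)))))"

text \<open>\<open>e\<close> is evaluated while some results are already in place, so its value may
  depend only on real cells outside \<open>{d..<d + m}\<close>.\<close>

lemma runs_rows_loop:
  assumes f: "f 0 = n" "f 1 = m"
    and base: "nval base (f, g) = b"
    and dst: "\<And>f' g'. (\<And>c. c \<notin> {3, 4, 6} \<Longrightarrow> f' c = f c) \<Longrightarrow> nval dst (f', g') = d"
    and e: "\<And>k i f' g'. k < m \<Longrightarrow> i < n \<Longrightarrow> (\<And>c. c \<notin> {3, 4, 6} \<Longrightarrow> f' c = f c) \<Longrightarrow>
      f' 3 = i \<Longrightarrow> f' 4 = b + k * n \<Longrightarrow> (\<And>j. j \<notin> {d..<d + m} \<Longrightarrow> g' j = g j) \<Longrightarrow>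
      rval e (f', g') = \<phi> k i"
    and Q: "\<And>f'. (\<And>c. c \<notin> {3, 4, 6} \<Longrightarrow> f' c = f c) \<Longrightarrow>
      Q f' (\<lambda>j. if j \<in> {d..<d + m} then \<Prod>i<n. \<phi> (j - d) i else g j)"
  shows "runs (rows_loop dst base e) f g (1 + (2 + m * (((1 + (2 + n * (1 + 2))) + 1) + 2))) Q"
proof -
  let ?g = "\<lambda>k j. if j \<in> {d..<d + k} then \<Prod>i<n. \<phi> (j - d) i else g j"
  show ?thesis
    unfolding rows_loop_def
  proof (intro runs_Seq_wp runs_NStore,
      rule runs_For[where J = "\<lambda>k f' g'. (\<forall>c. c \<notin> {3, 4, 6} \<longrightarrow> f' c = f c) \<and>
        f' 4 = b + k * n \<and> g' = ?g k" and k = m], goal_cases)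
    case 1
    show ?case using base by simp
  next
    case (2 k f' g')
    then show ?case using f by simp
  next
    case (3 k f' g')
    note k = 3
    show ?case
    proof (intro runs_Seq_wp, rule runs_prod_loop[where d = "d + k" and \<phi> = "\<phi> k"])
      show "f' 0 = n" using k f by simp
      show "nval (NAdd dst (reg 6)) (f'(3 := i), g'') = d + k" for i g''
        using k dst[of "f'(3 := i)" g''] by simp
      show "rval e (f'(3 := i), g'(d + k := y)) = \<phi> k i" if "i < n" for i y
        using k that by (intro e) auto
      have g': "g'(d + k := \<Prod>i<n. \<phi> k i) = ?g (Suc k)"
        using k by (auto simp: fun_eq_iff less_Suc_eq)
      show "runs (NStore (NConst 4) (NAdd (reg 4) (reg 0))) (f'(3 := n)) (g'(d + k := \<Prod>i<n. \<phi> k i)) 1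
         (\<lambda>f' g'. f' 6 = k \<and> (\<forall>c. c \<notin> {3, 4, 6} \<longrightarrow> (f'(6 := Suc k)) c = f c) \<and>
           (f'(6 := Suc k)) 4 = b + Suc k * n \<and> g' = ?g (Suc k))"
        by (rule runs_NStore) (use k f g' in auto)
    qed
  next
    case (4 f' g')
    then show ?case using Q by blast
  qed
qed

abbreviation rowA :: rexp where "rowA \<equiv> RLoad (NAdd (reg 4) (reg 3))"
abbreviation rowB :: rexp where "rowB \<equiv> RLoad (NAdd (reg 5) (reg 3))"

section \<open>Computing a vertex from an indicator vector\<close>

text \<open>The address \<open>n + 2 * m\<close> lies above the \<open>n\<close> inputs and is high
  enough for the \<open>2 * m\<close> results to be copied down to cell 0 without overlap.\<close>

definition solution_out :: nexp where
  "solution_out = NAdd (reg 0) (NAdd (reg 1) (reg 1))"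
definition solution_base :: nexp where
  "solution_base = NAdd solution_out (NAdd (reg 1) (reg 1))"

text \<open>With register 5 at 0, \<open>rowB\<close> reads \<open>x\<close>. For an incidence bit
  \<alpha>, the factor \<open>1 - \<alpha> * x\<close> is \<open>1 - x\<close> or 1, and
  \<open>1 - \<alpha> + \<alpha> * x\<close> is \<open>x\<close> or 1, so the products over all
  targets reduce to products over the members of the row.\<close>

definition solution_prog :: prog where
  "solution_prog =
     Seq (load_bits 2 solution_base (reg 1))
    (Seq (NStore (NConst 5) (NConst 0))
    (Seq (rows_loop solution_out solution_base (RSub (RConst 1) (RMul rowA rowB)))
    (Seq (rows_loop (NAdd solution_out (reg 1)) solution_base
           (RAdd (RSub (RConst 1) rowA) (RMul rowA rowB)))
         (copy_loop solution_out (NAdd (reg 1) (reg 1))))))"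

lemma runs_solution_prog:
  assumes f: "f 0 = n" "f 1 = m"
    and bits: "\<And>c. 2 \<le> c \<Longrightarrow> f c \<le> 1"
    and rest: "\<And>c. 2 + m * n \<le> c \<Longrightarrow> f c = 0"
    and a: "\<And>k i. k < m \<Longrightarrow> i < n \<Longrightarrow> real (f (2 + (k * n + i))) = \<alpha> k i"
    and zero: "\<And>j. n \<le> j \<Longrightarrow> g j = 0"
  shows "runs solution_prog f g (100 + 30 * m + 10 * (m * n)) (\<lambda>f' g'.
     (\<forall>k<m. g' k = (\<Prod>i<n. 1 - \<alpha> k i * g i)) \<and>
     (\<forall>k<m. g' (m + k) = (\<Prod>i<n. 1 - \<alpha> k i + \<alpha> k i * g i)))"
proof -
  define b where "b = n + m + m + (m + m)"
  define d where "d = n + m + m"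
  define g1 where "g1 = (\<lambda>j. if j < b then g j else real (f (2 + (j - b))))"
  have val: "nval solution_base s = b" "nval solution_out s = d"
    if "fst s 0 = n" "fst s 1 = m" for s
    using that by (auto simp: solution_base_def solution_out_def b_def d_def)
  let ?T1 = "1 + (2 + m * (((1 + (2 + n * (1 + 2))) + 1) + 2))"
  have "runs solution_prog f g ((30 + 3 * m + 4 * (m * f 0)) + (1 + (?T1 + (?T1 + (2 + (m + m) * (1 + 2)))))) (\<lambda>f' g'.
     (\<forall>k<m. g' k = (\<Prod>i<n. 1 - \<alpha> k i * g i)) \<and>
     (\<forall>k<m. g' (m + k) = (\<Prod>i<n. 1 - \<alpha> k i + \<alpha> k i * g i)))"
    unfolding solution_prog_def
  proof (rule runs_Seq_wp, rule runs_load_bits[where b = b])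
    fix f1 g1' assume f1: "\<And>c. c < 2 \<Longrightarrow> f1 c = f c"
      and g1': "g1' = (\<lambda>j. if j < b then g j else real (f (2 + (j - b))))"
    have f1': "f1 0 = n" "f1 1 = m" using f f1 by auto
    have "g1' = g1" unfolding g1' g1_def ..
    \<comment> \<open>Bits and input vector lie outside the block of results, so they stay readable
      during both passes.\<close>
    have A: "g' (b + k * n + i) = \<alpha> k i" and B: "g' i = g i"
      if "k < m" "i < n" "\<And>j. j \<notin> {d..<d + (m + m)} \<Longrightarrow> g' j = g1 j" for k i g'
      using that a[of k i] by (auto simp: d_def b_def g1_def add.assoc)
    show "runs
     (Seq (NStore (NConst 5) (NConst 0))
    (Seq (rows_loop solution_out solution_base (RSub (RConst 1) (RMul rowA rowB)))
    (Seq (rows_loop (NAdd solution_out (reg 1)) solution_base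
           (RAdd (RSub (RConst 1) rowA) (RMul rowA rowB)))
         (copy_loop solution_out (NAdd (reg 1) (reg 1)))))) f1 g1'
        (1 + (?T1 + (?T1 + (2 + (m + m) * (1 + 2))))) (\<lambda>f' g'.
     (\<forall>k<m. g' k = (\<Prod>i<n. 1 - \<alpha> k i * g i)) \<and>
     (\<forall>k<m. g' (m + k) = (\<Prod>i<n. 1 - \<alpha> k i + \<alpha> k i * g i)))"
      unfolding \<open>g1' = g1\<close>
    proof (intro runs_Seq_wp runs_NStore, rule runs_rows_loop[where b = b and d = d and n = n and m = m
          and \<phi> = "\<lambda>k i. 1 - \<alpha> k i * g i"], goal_cases)
      case (5 k i f' g')
      have "g' j = g1 j" if "j \<notin> {d..<d + (m + m)}" for j
        by (rule 5(6)) (use that in auto)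
      from A[OF 5(1,2) this] B[OF 5(1,2) this] show ?case using 5 by simp
    next
      case (6 f2)
      let ?g2 = "\<lambda>j. if j \<in> {d..<d + m} then \<Prod>i<n. 1 - \<alpha> (j - d) i * g i else g1 j"
      show ?case
      proof (rule runs_Seq_wp, rule runs_rows_loop[where b = b and d = "d + m" and n = n and m = m
          and \<phi> = "\<lambda>k i. 1 - \<alpha> k i + \<alpha> k i * g i"], goal_cases)
        case (5 k i f' g')
        have "g' j = g1 j" if "j \<notin> {d..<d + (m + m)}" for j
        proof -
          have "j \<notin> {d + m..<d + m + m}" "j \<notin> {d..<d + m}" using that by auto
          with 5(6)[of j] show ?thesis by (simp only: if_False simp_thms)
        qed
        from A[OF 5(1,2) this] B[OF 5(1,2) this] show ?case using 5 6 by simp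
      next
        case (6 f3)
        with \<open>\<And>c. c \<notin> {3, 4, 6} \<Longrightarrow> f2 c = _ c\<close> f1' show ?case
          by (intro runs_copy_loop[where s = d and k = "m + m"]) (auto simp: val d_def)
      qed (use f1' 6 in \<open>auto simp: val\<close>)
    qed (use f1' in \<open>auto simp: val\<close>)
  qed (use f bits rest zero in \<open>auto simp: val b_def\<close>)
  then show ?thesis by (rule runs_mono) (auto simp: f algebra_simps)
qed

section \<open>Computing the pseudo-Boolean weights\<close>

text \<open>The address \<open>2 * m + t + 1\<close> lies above the \<open>2 * m\<close> inputs and
  lets \<open>t + 1\<close> results be copied down without overlap. From there on follow
  \<open>t\<close> weights, the shift, three scratch cells and the incidence bits.\<close>

definition weights_out :: nexp where
  "weights_out = NAdd (NAdd (reg 1) (reg 1)) (NAdd (reg 2) (NConst 1))"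
definition weights_scratch :: "nat \<Rightarrow> nexp" where
  "weights_scratch k = NAdd weights_out (NAdd (reg 2) (NConst (Suc k)))"
definition weights_base :: nexp where
  "weights_base = weights_scratch 3"

text \<open>Treats one monomial, the row at register 5, against all members of \<open>S\<close>.
  Register 7 addresses the \<open>J\<close> weight of the current member, and its \<open>K\<close>
  weight lies \<open>m\<close> cells higher. Subtracting the contributions gives the sign of
  \<open>pseudo_boolean_weights\<close>.\<close>

definition weights_row :: prog where
  "weights_row = Seq (NStore (NConst 4) weights_base)
     (For 7 (reg 1)
       (Seq (prod_loop (weights_scratch 0) (RSub (RSub (RConst 1) rowB) (RMul rowA rowB)))
       (Seq (prod_loop (weights_scratch 1) (RSub (RConst 1) rowB))
       (Seq (prod_loop (weights_scratch 2)
              (RSub (RConst 1) (RMul (RSub rowA rowB) (RSub rowA rowB))))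
       (Seq (RStore (NAdd weights_out (reg 6))
              (RSub (RLoad (NAdd weights_out (reg 6)))
                (RAdd (RMul (RSub (RLoad (weights_scratch 0)) (RLoad (weights_scratch 1)))
                         (RLoad (reg 7)))
                      (RMul (RLoad (weights_scratch 2)) (RLoad (NAdd (reg 1) (reg 7)))))))
            (NStore (NConst 4) (NAdd (reg 4) (reg 0))))))))"

text \<open>
  For the incidence bits \<open>\<alpha>\<close> of \<open>A\<close> and \<open>\<beta>\<close> of \<open>V\<close>, the three products are \<open>(- 1) ^ card V\<close> if
  \<open>V \<subseteq> A\<close>, \<open>1\<close> if \<open>V = {}\<close>, and \<open>1\<close> if \<open>V = A\<close>, and \<open>0\<close> otherwise; the difference of the first
  two removes the constant term of the expansion.
\<close>

definition coefficients ::
  "nat \<Rightarrow> (nat \<Rightarrow> real) \<Rightarrow> (nat \<Rightarrow> real) \<Rightarrow> real \<Rightarrow> real \<Rightarrow> real" where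
  "coefficients n \<alpha> \<beta> u v =
     ((\<Prod>i<n. 1 - \<beta> i - \<alpha> i * \<beta> i) - (\<Prod>i<n. 1 - \<beta> i)) * u +
     (\<Prod>i<n. 1 - (\<alpha> i - \<beta> i) * (\<alpha> i - \<beta> i)) * v"

text \<open>The postcondition leaves the scratch cells open, as they keep values of the last round.
  \<open>b \<le> f 5\<close> places the row of the monomial above every real cell that is
  written.\<close>

lemma runs_weights_row:
  assumes f: "f 0 = n" "f 1 = m" "f 2 = t" "f 6 = r" "r < t"
    and d: "d = m + m + (t + 1)" and b: "b = d + (t + 4)"
    and \<alpha>: "\<And>k i. k < m \<Longrightarrow> i < n \<Longrightarrow> g (b + k * n + i) = \<alpha> k i"
    and \<beta>: "\<And>i. i < n \<Longrightarrow> g (f 5 + i) = \<beta> i" and "b \<le> f 5"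
    and Q: "\<And>f' g'. (\<And>c. c \<notin> {3, 4, 7} \<Longrightarrow> f' c = f c) \<Longrightarrow>
      (\<And>j. j \<notin> {d + t + 1..d + t + 3} \<Longrightarrow> g' j =
        (if j = d + r then g j - (\<Sum>k<m. coefficients n (\<alpha> k) \<beta> (g k) (g (m + k))) else g j)) \<Longrightarrow> Q f' g'"
  shows "runs weights_row f g (1 + (2 + m * (((1 + (2 + n * (1 + 2))) + ((1 + (2 + n * (1 + 2))) +
    ((1 + (2 + n * (1 + 2))) + (1 + 1)))) + 2))) Q"
proof -
  let ?S = "{d + t + 1..d + t + 3}"
  have val: "nval weights_base s = b" "nval weights_out s = d"
    "nval (weights_scratch k) s = d + t + Suc k"
    if "fst s 0 = n" "fst s 1 = m" "fst s 2 = t" for s k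
    using that by (auto simp: weights_base_def weights_scratch_def weights_out_def d b)
  let ?J = "\<lambda>k f' g'. (\<forall>c. c \<notin> {3, 4, 7} \<longrightarrow> f' c = f c) \<and> f' 4 = b + k * n \<and>
        (\<forall>j. j \<notin> ?S \<longrightarrow> g' j = (if j = d + r
          then g j - (\<Sum>k<k. coefficients n (\<alpha> k) \<beta> (g k) (g (m + k))) else g j))"
  show ?thesis
    unfolding weights_row_def
  proof (intro runs_Seq_wp runs_NStore, rule runs_For[where J = ?J and k = m], goal_cases)
    case 1
    show ?case using f by (simp add: val)
  next
    case (2 k f' g')
    then show ?case using f by simp
  next
    case (3 k f' g')
    note k = 3
    have f': "f' 0 = n" "f' 1 = m" "f' 2 = t" "f' 5 = f 5" "f' 6 = r" "f' 7 = k" "f' 4 = b + k * n"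
      using k f by auto
    let ?p0 = "\<Prod>i<n. 1 - \<beta> i - \<alpha> k i * \<beta> i" and ?p1 = "\<Prod>i<n. 1 - \<beta> i"
      and ?p2 = "\<Prod>i<n. 1 - (\<alpha> k i - \<beta> i) * (\<alpha> k i - \<beta> i)"
    let ?c0 = "d + t + Suc 0" and ?c1 = "d + t + Suc 1" and ?c2 = "d + t + Suc 2"
    \<comment> \<open>The inequalities allow both rows to be read through the scratch updates that
      follow.\<close>
    have A: "g' (b + k * n + i) = \<alpha> k i" "g' (f 5 + i) = \<beta> i"
      "b + k * n + i \<noteq> ?c0" "b + k * n + i \<noteq> ?c1" "b + k * n + i \<noteq> ?c2"
      "f 5 + i \<noteq> ?c0" "f 5 + i \<noteq> ?c1" "f 5 + i \<noteq> ?c2" if "i < n" for i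
    proof -
      have "b + k * n + i \<notin> ?S" "b + k * n + i \<noteq> d + r" "f 5 + i \<notin> ?S" "f 5 + i \<noteq> d + r"
        using \<open>b \<le> f 5\<close> \<open>r < t\<close> by (auto simp: b)
      then show "g' (b + k * n + i) = \<alpha> k i" "g' (f 5 + i) = \<beta> i"
        using that k \<alpha>[of k i] \<beta>[of i] by simp_all
    qed (use \<open>b \<le> f 5\<close> in \<open>auto simp: b\<close>)
    show ?case
    proof (rule runs_Seq_wp, rule runs_prod_loop[where n = n and d = ?c0
          and \<phi> = "\<lambda>i. 1 - \<beta> i - \<alpha> k i * \<beta> i"], goal_cases)
      case (3 i y)
      then show ?case using f' A[of i] by simp
    next
      case 4
      show ?case
      proof (rule runs_Seq_wp, rule runs_prod_loop[where n = n and d = ?c1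
            and \<phi> = "\<lambda>i. 1 - \<beta> i"], goal_cases)
        case (3 i y)
        then show ?case using f' A[of i] by simp
      next
        case 4
        show ?case
        proof (rule runs_Seq_wp, rule runs_prod_loop[where n = n and d = ?c2
              and \<phi> = "\<lambda>i. 1 - (\<alpha> k i - \<beta> i) * (\<alpha> k i - \<beta> i)"], goal_cases)
          case (3 i y)
          then show ?case
            using f' A[of i] by simp
        next
          case 4
          have g': "g' k = g k" "g' (m + k) = g (m + k)"
            "g' (d + r) = g (d + r) - (\<Sum>k<k. coefficients n (\<alpha> k) \<beta> (g k) (g (m + k)))"
            using k \<open>r < t\<close> by (auto simp: d)
          have ne: "?c0 \<noteq> k" "?c1 \<noteq> k" "?c2 \<noteq> k" "?c0 \<noteq> m + k" "?c1 \<noteq> m + k" "?c2 \<noteq> m + k"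
            "?c0 \<noteq> d + r" "?c1 \<noteq> d + r" "?c2 \<noteq> d + r"
            using k \<open>r < t\<close> by (auto simp: d)
          define g2 where "g2 = g'(?c0 := ?p0, ?c1 := ?p1, ?c2 := ?p2)"
          have g2: "g2 ?c0 = ?p0" "g2 ?c1 = ?p1" "g2 ?c2 = ?p2" "g2 k = g k" "g2 (m + k) = g (m + k)"
            "g2 (d + r) = g (d + r) - (\<Sum>k<k. coefficients n (\<alpha> k) \<beta> (g k) (g (m + k)))"
            "\<And>j. j \<notin> ?S \<Longrightarrow> g2 j = g' j"
            using g' ne by (auto simp: g2_def)
          show ?case
            unfolding g2_def[symmetric] fun_upd_upd
          proof (intro runs_Seq_wp runs_RStore runs_NStore, goal_cases)
            case 1
            show ?case
              using k f' g2 by (auto simp: val coefficients_def)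
          qed
        qed (use f' in \<open>auto simp: val\<close>)
      qed (use f' in \<open>auto simp: val\<close>)
    qed (use f' in \<open>auto simp: val\<close>)
  next
    case (4 f' g')
    then show ?case using Q by blast
  qed
qed

text \<open>
  The first loop accumulates the constant term and at the same time advances register 5 to the
  first row of the second family. The weights are built above the inputs and copied down at the end.
\<close>

definition weights_prog :: prog where
  "weights_prog =
     Seq (load_bits 3 weights_base (NAdd (reg 1) (reg 2)))
    (Seq (NStore (NConst 5) weights_base)
    (Seq (For 6 (reg 1)
           (Seq (RStore (NAdd weights_out (reg 2))
                  (RAdd (RLoad (NAdd weights_out (reg 2))) (RLoad (reg 6))))
                (NStore (NConst 5) (NAdd (reg 5) (reg 0)))))
    (Seq (For 6 (reg 2) (Seq weights_row (NStore (NConst 5) (NAdd (reg 5) (reg 0)))))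
         (copy_loop weights_out (NAdd (reg 2) (NConst 1))))))"

text \<open>Real memory is 0 above the inputs, so shift and weights can be accumulated in place. The
  term \<open>t * m * n\<close> comes from the products over \<open>n\<close> targets for each pair
  of a monomial and a member of \<open>S\<close>.\<close>

lemma runs_weights_prog:
  assumes f: "f 0 = n" "f 1 = m" "f 2 = t"
    and bits: "\<And>c. 3 \<le> c \<Longrightarrow> f c \<le> 1"
    and rest: "\<And>c. 3 + (m + t) * n \<le> c \<Longrightarrow> f c = 0"
    and \<alpha>: "\<And>k i. k < m \<Longrightarrow> i < n \<Longrightarrow> real (f (3 + (k * n + i))) = \<alpha> k i"
    and \<beta>: "\<And>k i. k < t \<Longrightarrow> i < n \<Longrightarrow> real (f (3 + (m * n + (k * n + i)))) = \<beta> k i"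
    and zero: "\<And>j. m + m \<le> j \<Longrightarrow> g j = 0"
  shows "runs weights_prog f g (100 + 30 * m + 30 * t + 10 * (m * n) + 10 * (t * n) + 30 * (m * t) +
      20 * (t * m * n)) (\<lambda>f' g'.
     (\<forall>r<t. g' r = - (\<Sum>k<m. coefficients n (\<alpha> k) (\<beta> r) (g k) (g (m + k)))) \<and>
     g' t = (\<Sum>k<m. g k))"
    (is "runs _ _ _ _ ?Q")
proof -
  define d where "d = m + m + (t + 1)"
  define b where "b = d + (t + 4)"
  define g1 where "g1 = (\<lambda>j. if j < b then g j else real (f (3 + (j - b))))"
  let ?S = "{d + t + 1..d + t + 3}"
  have val: "nval weights_base s = b" "nval weights_out s = d"
    if "fst s 0 = n" "fst s 1 = m" "fst s 2 = t" for s
    using that by (auto simp: weights_base_def weights_scratch_def weights_out_def d_def b_def)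
  let ?w = "\<lambda>r. \<Sum>k<m. coefficients n (\<alpha> k) (\<beta> r) (g k) (g (m + k))"
  let ?T0 = "1 + (2 + m * (((1 + (2 + n * (1 + 2))) + ((1 + (2 + n * (1 + 2))) +
    ((1 + (2 + n * (1 + 2))) + (1 + 1)))) + 2))"
  have "runs weights_prog f g ((30 + 3 * (m + t) + 4 * ((m + t) * f 0)) +
      (1 + ((2 + m * ((1 + 1) + 2)) + ((2 + t * ((?T0 + 1) + 2)) + (2 + (t + 1) * (1 + 2)))))) ?Q"
    unfolding weights_prog_def
  proof (rule runs_Seq_wp, rule runs_load_bits[where b = b], goal_cases)
    case (8 f1 g1')
    have f1: "f1 0 = n" "f1 1 = m" "f1 2 = t" using f 8 by auto
    have "g1' = g1" using 8 by (simp add: g1_def)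
    let ?J1 = "\<lambda>k f' g'. (\<forall>c. c \<notin> {3, 4, 5, 6, 7} \<longrightarrow> f' c = f1 c) \<and> f' 5 = b + k * n \<and>
      (\<forall>j. g' j = (if j = d + t then \<Sum>k<k. g k else g1 j))"
    show ?case
      unfolding \<open>g1' = g1\<close>
    proof (intro runs_Seq_wp runs_NStore, rule runs_For[where J = ?J1 and k = m], goal_cases)
      case 1
      then show ?case using f1 zero by (auto simp: val g1_def b_def d_def)
    next
      case (2 k f' g')
      then show ?case using f1 by simp
    next
      case (3 k f' g')
      then have f': "f' 0 = n" "f' 1 = m" "f' 2 = t" "f' 6 = k" using f1 by auto
      have "k \<noteq> d + t" "g1 k = g k" using 3 by (auto simp: d_def b_def g1_def)
      then show ?case
        using 3 f' by (intro runs_Seq_wp runs_RStore runs_NStore) (auto simp: val)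
    next
      case (4 f2 g2)
      let ?J2 = "\<lambda>k f' g'. (\<forall>c. c \<notin> {3, 4, 5, 6, 7} \<longrightarrow> f' c = f1 c) \<and> f' 5 = b + m * n + k * n \<and>
        (\<forall>j. j \<notin> ?S \<longrightarrow> g' j = (if j \<in> {d..<d + k} then - ?w (j - d) else g2 j))"
      show ?case
      proof (rule runs_Seq_wp, rule runs_For[where J = ?J2 and k = t], goal_cases)
        case 1
        show ?case using 4 by simp
      next
        case (2 k f' g')
        then show ?case using f1 by simp
      next
        case (3 r f' g')
        note r = 3
        have f': "f' 0 = n" "f' 1 = m" "f' 2 = t" "f' 6 = r" "f' 5 = b + m * n + r * n"
          using r f1 by auto
        \<comment> \<open>Earlier rounds have changed neither the bits nor the input weights, and
          cell \<open>d + r\<close> still holds its initial 0.\<close>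
        have high: "g' j = real (f (3 + (j - b)))" if "b \<le> j" for j
          using r 4 that by (auto simp: g1_def b_def)
        have low: "g' j = g j" if "j < m + m" for j
          using r 4 that by (auto simp: g1_def b_def d_def)
        have out: "g' (d + r) = 0"
          using r 4 zero by (auto simp: g1_def b_def d_def)
        show ?case
        proof (rule runs_Seq_wp, rule runs_weights_row[where d = d and b = b and r = r and \<alpha> = \<alpha>
              and \<beta> = "\<beta> r", OF f'(1-4) r(1) d_def b_def], goal_cases)
          case (1 k i)
          then show ?case using \<alpha>[of k i] by (simp add: high)
        next
          case (2 i)
          then show ?case using \<beta>[of r i] r by (simp add: f' high add.assoc)
        next
          case 3
          show ?case by (simp add: f')
        next
          case (4 f3 g3)
          have "(\<Sum>k<m. coefficients n (\<alpha> k) (\<beta> r) (g' k) (g' (m + k))) = ?w r"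
            by (intro sum.cong) (simp_all add: low)
          then show ?case
            using 4 r f' out by (intro runs_NStore) (auto simp: less_Suc_eq)
        qed
      next
        case (4 f3 g3)
        then have f3: "f3 0 = n" "f3 1 = m" "f3 2 = t" using f1 by auto
        have "g3 (d + r) = - ?w r" if "r < t" for r
          using 4 that by simp
        moreover have "g3 (d + t) = (\<Sum>k<m. g k)"
          using 4 \<open>?J1 m f2 g2\<close> by simp
        ultimately show ?case
          using f3 by (intro runs_copy_loop[where s = d and k = "t + 1"]) (auto simp: val d_def)
      qed
    qed
  qed (use f bits rest zero in \<open>auto simp: val b_def d_def\<close>)
  then show ?thesis by (rule runs_mono) (auto simp: f algebra_simps)
qed

section \<open>Weights for the converse direction\<close>

text \<open>A weight is written with opposite sign into the \<open>K\<close> block before its own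
  cell, now part of the \<open>J\<close> block, is cleared. The cell after both blocks stays 0 and
  is the shift.\<close>

definition negate_prog :: prog where
  "negate_prog = For 2 (reg 1)
     (Seq (RStore (NAdd (reg 1) (reg 2)) (RSub (RConst 0) (RLoad (reg 2))))
          (RStore (reg 2) (RConst 0)))"

lemma runs_negate_prog:
  assumes m: "f 1 = m" and zero: "\<And>j. m \<le> j \<Longrightarrow> g j = 0"
  shows "runs negate_prog f g (2 + m * ((1 + 1) + 2)) (\<lambda>f' g'.
     g' = (\<lambda>j. if j < m then 0 else if j < m + m then - g (j - m) else 0))"
  unfolding negate_prog_def
proof (rule runs_For[where k = m and J = "\<lambda>k f' g'. f' 1 = m \<and> g' = (\<lambda>j. if j < k then 0
      else if j < m then g j else if j < m + k then - g (j - m) else 0)"], goal_cases)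
  case (3 k f' g')
  then show ?case
    by (intro runs_Seq_wp runs_RStore) (auto simp: fun_eq_iff less_Suc_eq)
qed (use m zero in \<open>auto simp: fun_eq_iff\<close>)

section \<open>Encodings and the equivalence\<close>

lemma length_incidence_rows: "length (incidence_rows n As) = length As * n"
  unfolding incidence_rows_def by (induction As) auto

lemma nth_incidence_rows:
  assumes "k < length As" "i < n"
  shows "incidence_rows n As ! (k * n + i) = of_bool (Suc i \<in> As ! k)"
  using assms
proof (induction As arbitrary: k)
  case (Cons A As)
  have Cons': "incidence_rows n (A # As) =
      map (\<lambda>i. if i \<in> A then 1 else 0) [1..<Suc n] @ incidence_rows n As"
    unfolding incidence_rows_def by simp
  show ?case
  proof (cases k)
    case 0
    then show ?thesis using Cons.prems unfolding Cons' by (auto simp: nth_append simp del: upt_Suc)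
  next
    case (Suc k')
    then show ?thesis
      using Cons unfolding Cons' by (auto simp: nth_append simp del: upt_Suc)
  qed
qed simp

lemma incidence_rows_append: "incidence_rows n As @ incidence_rows n Bs = incidence_rows n (As @ Bs)"
  unfolding incidence_rows_def by simp

text \<open>Seen as one matrix for \<open>As @ Bs\<close>, two families can be loaded at once, a row
  of \<open>Bs\<close> being a row at offset \<open>length As\<close>.\<close>

lemma encode2_eq:
  "encode2 n As Bs = [n, length As, length Bs] @ incidence_rows n (As @ Bs)"
  unfolding encode2_def by (simp add: incidence_rows_append)

text \<open>The header \<open>hs\<close> is arbitrary to cover both encodings.\<close>

lemma initial_incidence_rows:
  fixes hs :: "nat list" and n :: nat and As :: "nat set list" and rs :: "real list"
  defines "f \<equiv> fst (initial (hs @ incidence_rows n As) rs)"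
  shows "k < length hs \<Longrightarrow> f k = hs ! k"
    and "length hs \<le> c \<Longrightarrow> f c \<le> 1"
    and "length hs + length As * n \<le> c \<Longrightarrow> f c = 0"
    and "k < length As \<Longrightarrow> i < n \<Longrightarrow> f (length hs + (k * n + i)) = of_bool (Suc i \<in> As ! k)"
proof -
  have idx: "k * n + i < length As * n" if "k < length As" "i < n" for k i
  proof -
    have "k * n + i < Suc k * n" using that by simp
    also have "\<dots> \<le> length As * n" using that by (intro mult_le_mono1) simp
    finally show ?thesis .
  qed
  have "x \<le> 1" if "x \<in> set (incidence_rows n As)" for x
    using that unfolding incidence_rows_def by (auto split: if_splits)
  then show "length hs \<le> c \<Longrightarrow> f c \<le> 1"
    unfolding f_def initial_def by (auto simp: nth_append)
  show "k < length hs \<Longrightarrow> f k = hs ! k" "length hs + length As * n \<le> c \<Longrightarrow> f c = 0"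
    unfolding f_def initial_def by (auto simp: nth_append length_incidence_rows)
  show "k < length As \<Longrightarrow> i < n \<Longrightarrow> f (length hs + (k * n + i)) = of_bool (Suc i \<in> As ! k)"
    unfolding f_def initial_def using idx[of k i] nth_incidence_rows[of k As i n]
    by (simp add: nth_append length_incidence_rows)
qed

text \<open>Passes from bit positions counted from 0 to targets counted from 1, bit \<open>i\<close>
  standing for target \<open>Suc i\<close>.\<close>

lemma prod_over_subset:
  fixes h :: "nat \<Rightarrow> real"
  assumes "A \<subseteq> {1..n}" "\<And>i. i \<in> {1..n} - A \<Longrightarrow> h i = 1" "\<And>i. i \<in> A \<Longrightarrow> h i = h' i"
  shows "(\<Prod>i<n. h (Suc i)) = (\<Prod>i\<in>A. h' i)"
proof -
  have "(\<Prod>i<n. h (Suc i)) = (\<Prod>i\<in>{1..n}. h i)"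
    using prod.atLeast1_atMost_eq[of h n] by simp
  also have "\<dots> = (\<Prod>i\<in>A. h' i)"
    using assms by (intro prod.mono_neutral_cong_right) auto
  finally show ?thesis .
qed

text \<open>Factor by factor: the first product has -1 on \<open>V \<inter> A\<close>, 0 on
  \<open>V - A\<close> and 1 elsewhere; the second has 0 exactly on \<open>V\<close>; the third has
  0 exactly on the symmetric difference of \<open>A\<close> and \<open>V\<close>.\<close>

lemma coefficients_eq:
  assumes A: "A \<subseteq> {1..n}" and V: "V \<subseteq> {1..n}"
  shows "coefficients n (\<lambda>i. of_bool (Suc i \<in> A)) (\<lambda>i. of_bool (Suc i \<in> V)) u v =
    (if V \<noteq> {} \<and> V \<subseteq> A then (- 1) ^ card V else 0) * u + (if V = A then 1 else 0) * v"
proof -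
  have fin: "finite V" using V finite_subset by blast
  have "(\<Prod>i<n. 1 - of_bool (Suc i \<in> V) - of_bool (Suc i \<in> A) * of_bool (Suc i \<in> V) :: real) =
      (\<Prod>i\<in>V. if i \<in> A then - 1 else 0)"
    using V by (intro prod_over_subset[where h = "\<lambda>i. 1 - of_bool (i \<in> V) - of_bool (i \<in> A) * of_bool (i \<in> V)"]) auto
  also have "\<dots> = (if V \<subseteq> A then (- 1) ^ card V else 0)"
    using fin by (auto simp: subset_iff intro!: prod_zero)
  finally have 0: "(\<Prod>i<n. 1 - of_bool (Suc i \<in> V) - of_bool (Suc i \<in> A) * of_bool (Suc i \<in> V) :: real) =
      (if V \<subseteq> A then (- 1) ^ card V else 0)" .
  have "(\<Prod>i<n. 1 - of_bool (Suc i \<in> V) :: real) = (\<Prod>i\<in>V. 0)"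
    using V by (intro prod_over_subset[where h = "\<lambda>i. 1 - of_bool (i \<in> V)"]) auto
  then have 1: "(\<Prod>i<n. 1 - of_bool (Suc i \<in> V) :: real) = (if V = {} then 1 else 0)"
    using fin by (simp add: card_gt_0_iff)
  have "(\<Prod>i<n. 1 - (of_bool (Suc i \<in> A) - of_bool (Suc i \<in> V)) *
        (of_bool (Suc i \<in> A) - of_bool (Suc i \<in> V)) :: real) = (\<Prod>i\<in>(A - V) \<union> (V - A). 0)"
    using A V by (intro prod_over_subset[where h = "\<lambda>i. 1 - (of_bool (i \<in> A) - of_bool (i \<in> V)) *
        (of_bool (i \<in> A) - of_bool (i \<in> V))"]) auto
  moreover have "finite ((A - V) \<union> (V - A))" using A V finite_subset by blast
  ultimately have 2: "(\<Prod>i<n. 1 - (of_bool (Suc i \<in> A) - of_bool (Suc i \<in> V)) *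
        (of_bool (Suc i \<in> A) - of_bool (Suc i \<in> V)) :: real) = (if V = A then 1 else 0)"
    by auto
  show ?thesis unfolding coefficients_def 0 1 2 by auto
qed

section \<open>Correctness of the three programs\<close>

lemma computes_solution_map_vertex_map:
  assumes S: "S \<subseteq> Pow {1..n}"
    and T: "100 + 30 * card S + 10 * (card S * n) \<le> poly p n"
  shows "computes_solution_map solution_prog p n \<D> S (vertex_map S)"
  unfolding computes_solution_map_def
proof (intro allI impI ballI)
  fix As x assume "lists_family As S" and "x \<in> set_system \<D>"
  then have As: "distinct As" "set As = S" unfolding lists_family_def by auto
  let ?m = "length As"
  have m: "card S = ?m" using As distinct_card by blast
  define rs where "rs = map x [1..<Suc n]"
  have enc: "encode1 n As = [n, ?m] @ incidence_rows n As" by (simp add: encode1_def)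
  define f where "f = fst (initial (encode1 n As) rs)"
  define g where "g = snd (initial (encode1 n As) rs)"
  note init = initial_incidence_rows[where hs = "[n, ?m]" and n = n and As = As and rs = rs, folded enc, folded f_def]
  have g: "g j = (if j < n then x (Suc j) else 0)" for j
    unfolding g_def initial_def rs_def by (simp del: upt_Suc)
  have sub: "As ! k \<subseteq> {1..n}" if "k < ?m" for k using that As S nth_mem by blast
  have J: "(\<Prod>i<n. 1 - of_bool (Suc i \<in> As ! k) * g i) = (\<Prod>i\<in>As ! k. 1 - x i)"
    and K: "(\<Prod>i<n. 1 - of_bool (Suc i \<in> As ! k) + of_bool (Suc i \<in> As ! k) * g i) = (\<Prod>i\<in>As ! k. x i)"
    if "k < ?m" for k
  proof -
    have "(\<Prod>i<n. 1 - of_bool (Suc i \<in> As ! k) * x (Suc i)) = (\<Prod>i\<in>As ! k. 1 - x i)"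
      using sub[OF that] by (intro prod_over_subset[where h = "\<lambda>i. 1 - of_bool (i \<in> As ! k) * x i"]) auto
    then show "(\<Prod>i<n. 1 - of_bool (Suc i \<in> As ! k) * g i) = (\<Prod>i\<in>As ! k. 1 - x i)"
      by (simp add: g)
    have "(\<Prod>i<n. 1 - of_bool (Suc i \<in> As ! k) + of_bool (Suc i \<in> As ! k) * x (Suc i)) =
        (\<Prod>i\<in>As ! k. x i)"
      using sub[OF that] by (intro prod_over_subset[where
            h = "\<lambda>i. 1 - of_bool (i \<in> As ! k) + of_bool (i \<in> As ! k) * x i"]) auto
    then show "(\<Prod>i<n. 1 - of_bool (Suc i \<in> As ! k) + of_bool (Suc i \<in> As ! k) * g i) =
        (\<Prod>i\<in>As ! k. x i)"
      by (simp add: g)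
  qed
  have "runs solution_prog f g (100 + 30 * ?m + 10 * (?m * n)) (\<lambda>f' g'.
     (\<forall>k<?m. g' k = (\<Prod>i<n. 1 - of_bool (Suc i \<in> As ! k) * g i)) \<and>
     (\<forall>k<?m. g' (?m + k) = (\<Prod>i<n. 1 - of_bool (Suc i \<in> As ! k) + of_bool (Suc i \<in> As ! k) * g i)))"
    by (rule runs_solution_prog) (use init g in auto)
  then have "runs solution_prog f g (100 + 30 * ?m + 10 * (?m * n))
    (\<lambda>f g. \<forall>k<length (map (vertex_map S x) (double_index As)).
      g k = map (vertex_map S x) (double_index As) ! k)"
  proof (rule runs_mono)
    fix f' g' assume out: "(\<forall>k<?m. g' k = (\<Prod>i<n. 1 - of_bool (Suc i \<in> As ! k) * g i)) \<and>
     (\<forall>k<?m. g' (?m + k) = (\<Prod>i<n. 1 - of_bool (Suc i \<in> As ! k) + of_bool (Suc i \<in> As ! k) * g i))"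
    have high: "g' k = (\<Prod>i\<in>As ! (k - ?m). x i)" if "?m \<le> k" "k < ?m + ?m" for k
    proof -
      have "k - ?m < ?m" using that by linarith
      then have "g' (?m + (k - ?m)) = (\<Prod>i\<in>As ! (k - ?m). x i)" using out K by simp
      then show ?thesis using that by simp
    qed
    show "\<forall>k<length (map (vertex_map S x) (double_index As)).
      g' k = map (vertex_map S x) (double_index As) ! k"
      using out J high As
      by (auto simp: double_index_def nth_append vertex_map_def proj_pair_def)
  qed simp
  then show "computes_within solution_prog (poly p n) (encode1 n As) (map x [1..<Suc n])
      (map (vertex_map S x) (double_index As))"
    unfolding f_def g_def rs_def by (rule computes_within_runs) (use T m in simp)
qed

text \<open>The common ending of both reductions, which only have to supply
  \<open>eq\<close>.\<close>

lemma same_optimum_vertex_map: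
  assumes D: "\<D> \<subseteq> Pow {1..n}" "\<D> \<noteq> {}" and S: "S \<subseteq> Pow {1..n}"
    and eq: "\<And>x. f x = b - oracle_objective S w (vertex_map S x)"
  shows "same_optimum (vertex_map S) (set_system \<D>) f
    (defender_vertices n \<D> S) (oracle_objective S w) b"
proof (rule same_optimumI)
  have "finite \<D>" using D finite_subset by blast
  then show "finite (set_system \<D>)" "set_system \<D> \<noteq> {}"
    using D unfolding set_system_def by auto
  show "vertex_map S ` set_system \<D> = defender_vertices n \<D> S"
    using defender_vertices_eq[OF D(1) S] by simp
qed (rule eq)

lemma pseudo_boolean_to_oracle_vertex_map:
  assumes D: "\<D> \<subseteq> Pow {1..n}" "\<D> \<noteq> {}" and S: "S \<subseteq> Pow {1..n}"
    and T: "2 + 4 * card S \<le> poly p n"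
  shows "pseudo_boolean_to_oracle negate_prog p n \<D> S (vertex_map S)"
  unfolding pseudo_boolean_to_oracle_def
proof (intro allI impI)
  fix As and w :: "nat set \<Rightarrow> real" assume "lists_family As S"
  then have As: "distinct As" "set As = S" unfolding lists_family_def by auto
  let ?m = "length As"
  have m: "card S = ?m" using As distinct_card by blast
  have fin: "finite S" using As by auto
  \<comment> \<open>On the \<open>K\<close> block the vertex coordinates are the monomials
    themselves; the sign turns maximization into minimization.\<close>
  define w' where "w' i = (case i of Inl A \<Rightarrow> 0 | Inr A \<Rightarrow> - w A)" for i :: "nat set + nat set"
  define f where "f = fst (initial (encode1 n As) (map w As))"
  define g where "g = snd (initial (encode1 n As) (map w As))"
  have f: "f 1 = ?m" unfolding f_def initial_def encode1_def by simp
  have g: "g j = (if j < ?m then w (As ! j) else 0)" for j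
    unfolding g_def initial_def by simp
  have "runs negate_prog f g (2 + ?m * ((1 + 1) + 2)) (\<lambda>f' g'.
     g' = (\<lambda>j. if j < ?m then 0 else if j < ?m + ?m then - g (j - ?m) else 0))"
    by (rule runs_negate_prog) (use f g in auto)
  then have "runs negate_prog f g (2 + ?m * ((1 + 1) + 2)) (\<lambda>f g.
      \<forall>k<length (map w' (double_index As) @ [0]). g k = (map w' (double_index As) @ [0]) ! k)"
    by (rule runs_mono) (auto simp: g double_index_def nth_append w'_def less_Suc_eq)
  then have "computes_within negate_prog (poly p n) (encode1 n As) (map w As)
      (map w' (double_index As) @ [0])"
    unfolding f_def g_def by (rule computes_within_runs) (use T m in simp)
  moreover have "pseudo_boolean S w x = 0 - oracle_objective S w' (vertex_map S x)" for x
    unfolding oracle_objective_vertex_map[OF fin] pseudo_boolean_def w'_def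
    by (simp add: sum_negf)
  then have "same_optimum (vertex_map S) (set_system \<D>) (pseudo_boolean S w)
      (defender_vertices n \<D> S) (oracle_objective S w') 0"
    by (rule same_optimum_vertex_map[OF D S])
  ultimately show "\<exists>w' b. computes_within negate_prog (poly p n) (encode1 n As) (map w As)
      (map w' (double_index As) @ [b]) \<and>
    same_optimum (vertex_map S) (set_system \<D>) (pseudo_boolean S w)
      (defender_vertices n \<D> S) (oracle_objective S w') b" by blast
qed

lemma oracle_to_pseudo_boolean_vertex_map:
  assumes D: "\<D> \<subseteq> Pow {1..n}" "\<D> \<noteq> {}" and S: "S \<subseteq> Pow {1..n}"
    and T: "100 + 30 * card S + 30 * card (subset_hull S) + 10 * (card S * n) +
      10 * (card (subset_hull S) * n) + 30 * (card S * card (subset_hull S)) +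
      20 * (card (subset_hull S) * card S * n) \<le> poly p n"
  shows "oracle_to_pseudo_boolean weights_prog p n \<D> S (subset_hull S) (vertex_map S)"
  unfolding oracle_to_pseudo_boolean_def
proof (intro allI impI)
  fix As Bs w assume "lists_family As S" "lists_family Bs (subset_hull S)"
  then have As: "distinct As" "set As = S" and Bs: "distinct Bs" "set Bs = subset_hull S"
    unfolding lists_family_def by auto
  let ?m = "length As" and ?t = "length Bs"
  have m: "card S = ?m" "card (subset_hull S) = ?t" using As Bs distinct_card by metis+
  have hull: "subset_hull S \<subseteq> Pow {1..n}" using S unfolding subset_hull_def by blast
  define w' where "w' = pseudo_boolean_weights S w"
  define b where "b = (\<Sum>A\<in>S. w (Inl A))"
  define rs where "rs = map w (double_index As)"
  define f where "f = fst (initial (encode2 n As Bs) rs)"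
  define g where "g = snd (initial (encode2 n As Bs) rs)"
  note init = initial_incidence_rows[where hs = "[n, ?m, ?t]" and n = n and As = "As @ Bs" and rs = rs, folded encode2_eq, folded f_def]
  have g: "g j = (if j < ?m then w (Inl (As ! j)) else if j < ?m + ?m then w (Inr (As ! (j - ?m))) else 0)" for j
    unfolding g_def initial_def rs_def double_index_def by (auto simp: nth_append)
  \<comment> \<open>\<open>As\<close> lists \<open>S\<close> without repetition, so row numbers can
    replace members in sums.\<close>
  have sum_As: "(\<Sum>k<?m. h (As ! k)) = (\<Sum>A\<in>S. h A)" for h :: "nat set \<Rightarrow> real"
    using sum.reindex_bij_betw[OF bij_betw_nth[OF As(1) refl As(2)[symmetric]], of h] by simp
  let ?\<alpha> = "\<lambda>k i. of_bool (Suc i \<in> As ! k) :: real" and ?\<beta> = "\<lambda>k i. of_bool (Suc i \<in> Bs ! k) :: real"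
  have \<beta>: "f (3 + (?m * n + (k * n + i))) = of_bool (Suc i \<in> Bs ! k)" if "k < ?t" "i < n" for k i
    using init(4)[of "?m + k" i] that by (simp add: nth_append add_mult_distrib add.assoc numeral_3_eq_3)
  have weights: "- (\<Sum>k<?m. coefficients n (?\<alpha> k) (?\<beta> r) (g k) (g (?m + k))) = w' (Bs ! r)"
    if "r < ?t" for r
  proof -
    have V: "Bs ! r \<subseteq> {1..n}" using that Bs hull nth_mem by blast
    have A: "As ! k \<subseteq> {1..n}" if "k < ?m" for k using that As S nth_mem by blast
    show ?thesis
      unfolding w'_def pseudo_boolean_weights_def sum_As[symmetric]
      by (simp add: coefficients_eq[OF A V] g)
  qed
  have const: "(\<Sum>k<?m. g k) = b" unfolding b_def sum_As[symmetric] by (simp add: g)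
  have "runs weights_prog f g (100 + 30 * ?m + 30 * ?t + 10 * (?m * n) + 10 * (?t * n) +
      30 * (?m * ?t) + 20 * (?t * ?m * n)) (\<lambda>f' g'.
     (\<forall>r<?t. g' r = - (\<Sum>k<?m. coefficients n (?\<alpha> k) (?\<beta> r) (g k) (g (?m + k)))) \<and>
     g' ?t = (\<Sum>k<?m. g k))"
  proof (rule runs_weights_prog)
    show "real (f (3 + (k * n + i))) = ?\<alpha> k i" if "k < ?m" "i < n" for k i
      using init(4)[of k i] that by (simp add: nth_append numeral_3_eq_3)
    show "real (f (3 + (?m * n + (k * n + i)))) = ?\<beta> k i" if "k < ?t" "i < n" for k i
      using \<beta>[OF that] by simp
  qed (use init(1)[of 0] init(1)[of 1] init(1)[of 2] init(2,3) g in auto)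
  then have "runs weights_prog f g (100 + 30 * ?m + 30 * ?t + 10 * (?m * n) + 10 * (?t * n) +
      30 * (?m * ?t) + 20 * (?t * ?m * n))
      (\<lambda>f g. \<forall>k<length (map w' Bs @ [b]). g k = (map w' Bs @ [b]) ! k)"
    by (rule runs_mono) (auto simp: weights const nth_append less_Suc_eq)
  then have "computes_within weights_prog (poly p n) (encode2 n As Bs) (map w (double_index As))
      (map w' Bs @ [b])"
    unfolding f_def g_def rs_def by (rule computes_within_runs) (use T m in simp)
  moreover have "same_optimum (vertex_map S) (set_system \<D>) (pseudo_boolean (subset_hull S) w')
      (defender_vertices n \<D> S) (oracle_objective S w) b"
    unfolding w'_def b_def
    by (rule same_optimum_vertex_map[OF D S pseudo_boolean_weights_correct[OF S]])
  ultimately show "\<exists>w' b. computes_within weights_prog (poly p n) (encode2 n As Bs)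
      (map w (double_index As)) (map w' Bs @ [b]) \<and>
    same_optimum (vertex_map S) (set_system \<D>) (pseudo_boolean (subset_hull S) w')
      (defender_vertices n \<D> S) (oracle_objective S w) b" by blast
qed

theorem theorem9:
  fixes c :: nat
  assumes "c > 1"
  shows "\<exists>(F :: prog) (F' :: prog) (G :: prog) (p :: nat poly).
    \<forall>(n :: nat) (\<D> :: nat set set) (Ba :: nat set \<Rightarrow> real) (La :: nat set \<Rightarrow> real)
      (Bd :: nat set \<Rightarrow> real) (Ld :: nat set \<Rightarrow> real) (S :: nat set set).
      \<D> \<subseteq> Pow {1..n} \<longrightarrow> \<D> \<noteq> {} \<longrightarrow> S = support_set n c Ba La Bd Ld \<longrightarrow>
      (\<exists>g. computes_solution_map G p n \<D> S g \<and>
           pseudo_boolean_to_oracle F' p n \<D> S g \<and>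
           oracle_to_pseudo_boolean F p n \<D> S (subset_hull S) g \<and>
           (subset_hull S = S \<longrightarrow> oracle_to_pseudo_boolean F p n \<D> S S g))"
proof -
  \<comment> \<open>230 is the sum of the coefficients in the largest time bound. Both families have
    at most \<open>M = (n + 1) ^ c\<close> members, so each monomial of the bound is at most
    \<open>M * M * (n + 1)\<close>, hence the exponent. Only \<open>p\<close> depends on
    \<open>c\<close>; the programs are the same for all \<open>c\<close>.\<close>
  define p :: "nat poly" where "p = [:230:] * [:1, 1:] ^ (2 * c + 1)"
  show ?thesis
  proof (rule exI[of _ weights_prog], rule exI[of _ negate_prog], rule exI[of _ solution_prog],
      rule exI[of _ p], intro allI impI)
    fix n :: nat and \<D> S :: "nat set set" and Ba La Bd Ld :: "nat set \<Rightarrow> real"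
    assume D: "\<D> \<subseteq> Pow {1..n}" "\<D> \<noteq> {}" and "S = support_set n c Ba La Bd Ld"
    then have S: "S \<subseteq> attacks n c" unfolding support_set_def by blast
    then have Pow: "S \<subseteq> Pow {1..n}" unfolding attacks_def by blast
    have finA: "finite (attacks n c)"
      by (rule finite_subset[of _ "Pow {1..n}"]) (auto simp: attacks_def)
    \<comment> \<open>Subsets of attack sets are attack sets, so the enlarged family obeys the same
      count.\<close>
    have hull: "subset_hull S \<subseteq> attacks n c"
    proof
      fix V assume "V \<in> subset_hull S"
      then obtain A where A: "A \<in> attacks n c" "V \<subseteq> A"
        using S unfolding subset_hull_def by blast
      then have "finite A" unfolding attacks_def using finite_subset by blast
      with A show "V \<in> attacks n c" unfolding attacks_def using card_mono[of A V] by auto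
    qed
    define m t M where "m = card S" and "t = card (subset_hull S)" and "M = (n + 1) ^ c"
    have mt: "m \<le> M" "t \<le> M"
      using card_mono[OF finA S] card_mono[OF finA hull] card_attacks_le[of n c]
      unfolding m_def t_def M_def by linarith+
    define X where "X = M * M * (n + 1)"
    have p: "poly p n = 230 * X"
      unfolding p_def X_def M_def by (simp add: power_add mult_2 mult_2_right algebra_simps)
    have M: "1 \<le> M" unfolding M_def by simp
    have X: "a * b * d \<le> X" if "a \<le> M" "b \<le> M" "d \<le> n + 1" for a b d
      unfolding X_def using that by (intro mult_le_mono)
    have "1 * 1 * 1 \<le> X" "m * 1 * 1 \<le> X" "t * 1 * 1 \<le> X" "m * 1 * n \<le> X" "t * 1 * n \<le> X"
      "m * t * 1 \<le> X" "t * m * n \<le> X"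
      using mt M by (intro X; simp)+
    then have bounds: "1 \<le> X" "m \<le> X" "t \<le> X" "m * n \<le> X" "t * n \<le> X" "m * t \<le> X" "t * m * n \<le> X"
      by simp_all
    have "100 + 30 * m + 10 * (m * n) \<le> poly p n" "2 + 4 * m \<le> poly p n"
      "100 + 30 * m + 30 * t + 10 * (m * n) + 10 * (t * n) + 30 * (m * t) + 20 * (t * m * n) \<le> poly p n"
      unfolding p using bounds by linarith+
    note T = this[unfolded m_def t_def]
    have F: "oracle_to_pseudo_boolean weights_prog p n \<D> S (subset_hull S) (vertex_map S)"
      by (rule oracle_to_pseudo_boolean_vertex_map[OF D Pow T(3)])
    show "\<exists>g. computes_solution_map solution_prog p n \<D> S g \<and>
       pseudo_boolean_to_oracle negate_prog p n \<D> S g \<and>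
       oracle_to_pseudo_boolean weights_prog p n \<D> S (subset_hull S) g \<and>
       (subset_hull S = S \<longrightarrow> oracle_to_pseudo_boolean weights_prog p n \<D> S S g)"
    proof (intro exI[of _ "vertex_map S"] conjI impI)
      show "oracle_to_pseudo_boolean weights_prog p n \<D> S S (vertex_map S)" if "subset_hull S = S"
        using F unfolding that .
    qed (fact F computes_solution_map_vertex_map[OF Pow T(1)]
          pseudo_boolean_to_oracle_vertex_map[OF D Pow T(2)])+
  qed
qed

end
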